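(* Let $A$ be a unital $C^*$-algebra, let $\mathcal{H}$ be a finitely or countably generated Hilbert $A$-module, and let $\Psi=\{\psi_j\in\mathcal{H}: j\in J\}$ be a frame for $\mathcal{H}$. Let $m=\{m_j\}_{j\in J}\subseteq Z(A)$ be a positive and semi-normalized sequence. Then the multiplier $M_{m,\Psi}$, given by $M_{m,\Psi}f=\sum_{j\in J}m_j\langle f,\psi_j\rangle\psi_j$, is the frame operator of the frame $\{\sqrt{m_j}\,\psi_j: j\in J\}$, and therefore it is positive, self-adjoint and invertible. If instead $\{m_j\}_{j\in J}\subseteq Z(A)$ is negative and semi-normalized, then $M_{m,\Psi}$ is negative, self-adjoint and invertible.
   Context: Hilbert $A$-modules are left modules, with $A$-valued inner product $\langle\cdot,\cdot\rangle$ that is $A$-linear in the first variable, and norm $\|f\|=\|\langle f,f\rangle\|^{1/2}$. $J$ is a finite or countable index set. $Z(A)$ is the center of $A$. A family $\{\psi_j\}_{j\in J}\subseteq\mathcal{H}$ is a frame if there are constants $\alpha,\beta>0$ with $\alpha\langle f,f\rangle\le\sum_{j\in J}\langle f,\psi_j\rangle\langle\psi_j,f\rangle\le\beta\langle f,f\rangle$ for all $f\in\mathcal{H}$ (order of $A$, norm-convergent sum); its frame operator is $Sf=\sum_{j\in J}\langle f,\psi_j\rangle\psi_j$. A sequence $\{c_j\}_{j\in J}\subseteq Z(A)$ is semi-normalized if there are real bounds $b\ge a>0$ with $a\le|c_j|\le b$ for all $j$ (order of $A$; $a,b$ denote multiples of the unit; $|c|=(c^*c)^{1/2}$). It is positive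 if each $c_j\ge0$ and negative if each $-c_j\ge0$. An operator $T$ is negative if $-T$ is positive. *)

theory Defs
  imports "HOL-Analysis.Analysis"
begin

text \<open>
  The real Banach algebra structure comes from the library classes; the class adds the complex
  scalar multiplication extending \<open>scaleR\<close>, the involution, and the C*-identity.
\<close>

class cstar_algebra = real_normed_algebra_1 + banach +
  fixes scaleC :: "complex \<Rightarrow> 'a \<Rightarrow> 'a" (infixr "*\<^sub>C" 75)
    and star :: "'a \<Rightarrow> 'a"
  assumes scaleC_add_right: "c *\<^sub>C (x + y) = c *\<^sub>C x + c *\<^sub>C y"
    and scaleC_add_left: "(c + d) *\<^sub>C x = c *\<^sub>C x + d *\<^sub>C x"
    and scaleC_scaleC: "c *\<^sub>C (d *\<^sub>C x) = (c * d) *\<^sub>C x"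
    and scaleC_of_real: "complex_of_real r *\<^sub>C x = r *\<^sub>R x"
    and scaleC_mult_left: "(c *\<^sub>C x) * y = c *\<^sub>C (x * y)"
    and scaleC_mult_right: "x * (c *\<^sub>C y) = c *\<^sub>C (x * y)"
    and norm_scaleC: "norm (c *\<^sub>C x) = cmod c * norm x"
    and star_star: "star (star x) = x"
    and star_add: "star (x + y) = star x + star y"
    and star_scaleC: "star (c *\<^sub>C x) = cnj c *\<^sub>C star x"
    and star_mult: "star (x * y) = star y * star x"
    and cstar_identity: "norm (star x * x) = (norm x)\<^sup>2"

definition alg_center :: "'a::cstar_algebra set" where
  "alg_center = {c. \<forall>x. c * x = x * c}"

definition alg_invertible :: "'a::cstar_algebra \<Rightarrow> bool" where
  "alg_invertible x \<longleftrightarrow> (\<exists>y. x * y = 1 \<and> y * x = 1)"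

definition alg_spectrum :: "'a::cstar_algebra \<Rightarrow> complex set" where
  "alg_spectrum x = {z. \<not> alg_invertible (x - z *\<^sub>C 1)}"

definition cstar_pos :: "'a::cstar_algebra \<Rightarrow> bool" where
  "cstar_pos x \<longleftrightarrow> star x = x \<and> alg_spectrum x \<subseteq> complex_of_real ` {0..}"

definition cstar_le :: "'a::cstar_algebra \<Rightarrow> 'a \<Rightarrow> bool" (infix "\<sqsubseteq>\<^sub>A" 50) where
  "x \<sqsubseteq>\<^sub>A y \<longleftrightarrow> cstar_pos (y - x)"

text \<open>The unique positive square root; only meaningful on positive elements.\<close>

definition cstar_sqrt :: "'a::cstar_algebra \<Rightarrow> 'a" where
  "cstar_sqrt x = (THE y. cstar_pos y \<and> y * y = x)"

definition cstar_abs :: "'a::cstar_algebra \<Rightarrow> 'a" where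
  "cstar_abs x = cstar_sqrt (star x * x)"

text \<open>
  Left Hilbert modules, with inner product \<open>ip\<close> linear in the first variable. The class
  \<^class>\<open>banach\<close> on the module type supplies completeness and convergence of sums; \<open>norm_ip\<close>
  forces its norm to be the one given by the inner product. As the algebra is unital, the complex
  scalars act on the module through multiples of the unit, and \<open>scaleR_act\<close> says that the
  library's real scalars do so as well.
\<close>

locale hilbert_module =
  fixes act :: "'a::cstar_algebra \<Rightarrow> 'h::banach \<Rightarrow> 'h"
    and ip :: "'h \<Rightarrow> 'h \<Rightarrow> 'a"
  assumes act_add_right: "act a (f + g) = act a f + act a g"
    and act_add_left: "act (a + b) f = act a f + act b f"
    and act_act: "act a (act b f) = act (a * b) f"
    and act_one: "act 1 f = f"
    and scaleR_act: "r *\<^sub>R f = act (r *\<^sub>R 1) f"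
    and ip_add_left: "ip (f + g) h = ip f h + ip g h"
    and ip_act_left: "ip (act a f) g = a * ip f g"
    and ip_star: "ip f g = star (ip g f)"
    and ip_pos: "0 \<sqsubseteq>\<^sub>A ip f f"
    and ip_definite: "ip f f = 0 \<Longrightarrow> f = 0"
    and norm_ip: "norm f = sqrt (norm (ip f f))"

definition module_span :: "('a::cstar_algebra \<Rightarrow> 'h::banach \<Rightarrow> 'h) \<Rightarrow> 'h set \<Rightarrow> 'h set" where
  "module_span act X = {\<Sum>x\<in>F. act (a x) x | F a. finite F \<and> F \<subseteq> X}"

definition finitely_generated :: "('a::cstar_algebra \<Rightarrow> 'h::banach \<Rightarrow> 'h) \<Rightarrow> bool" where
  "finitely_generated act \<longleftrightarrow> (\<exists>X. finite X \<and> module_span act X = UNIV)"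

definition countably_generated :: "('a::cstar_algebra \<Rightarrow> 'h::banach \<Rightarrow> 'h) \<Rightarrow> bool" where
  "countably_generated act \<longleftrightarrow> (\<exists>X. countable X \<and> closure (module_span act X) = UNIV)"

text \<open>
  Additivity, linearity over the algebra and boundedness of a map follow from the existence of an
  adjoint.
\<close>

definition adjointable :: "('h \<Rightarrow> 'h \<Rightarrow> 'a::cstar_algebra) \<Rightarrow> ('h::banach \<Rightarrow> 'h) \<Rightarrow> bool" where
  "adjointable ip T \<longleftrightarrow> (\<exists>T'. \<forall>f g. ip (T f) g = ip f (T' g))"

definition op_self_adjoint :: "('h \<Rightarrow> 'h \<Rightarrow> 'a::cstar_algebra) \<Rightarrow> ('h::banach \<Rightarrow> 'h) \<Rightarrow> bool" where
  "op_self_adjoint ip T \<longleftrightarrow> (\<forall>f g. ip (T f) g = ip f (T g))"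

definition op_positive :: "('h \<Rightarrow> 'h \<Rightarrow> 'a::cstar_algebra) \<Rightarrow> ('h::banach \<Rightarrow> 'h) \<Rightarrow> bool" where
  "op_positive ip T \<longleftrightarrow> adjointable ip T \<and> (\<forall>f. 0 \<sqsubseteq>\<^sub>A ip (T f) f)"

definition op_negative :: "('h \<Rightarrow> 'h \<Rightarrow> 'a::cstar_algebra) \<Rightarrow> ('h::banach \<Rightarrow> 'h) \<Rightarrow> bool" where
  "op_negative ip T \<longleftrightarrow> op_positive ip (\<lambda>f. - T f)"

definition op_invertible :: "('h \<Rightarrow> 'h \<Rightarrow> 'a::cstar_algebra) \<Rightarrow> ('h::banach \<Rightarrow> 'h) \<Rightarrow> bool" where
  "op_invertible ip T \<longleftrightarrow>
     adjointable ip T \<and> (\<exists>R. adjointable ip R \<and> (\<forall>f. R (T f) = f) \<and> (\<forall>f. T (R f) = f))"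

text \<open>
  Sums over the index set are unconditional norm limits over its finite subsets. In the frame
  inequality all summands are positive, so convergence along one enumeration of a countable
  index set is already unconditional.
\<close>

definition is_frame :: "('h \<Rightarrow> 'h \<Rightarrow> 'a::cstar_algebra) \<Rightarrow> 'j set \<Rightarrow> ('j \<Rightarrow> 'h::banach) \<Rightarrow> bool" where
  "is_frame ip J \<psi> \<longleftrightarrow>
     (\<exists>\<alpha> \<beta> :: real. 0 < \<alpha> \<and> 0 < \<beta> \<and>
        (\<forall>f. (\<lambda>j. ip f (\<psi> j) * ip (\<psi> j) f) summable_on J \<and>
             \<alpha> *\<^sub>R ip f f \<sqsubseteq>\<^sub>A (\<Sum>\<^sub>\<infinity>j\<in>J. ip f (\<psi> j) * ip (\<psi> j) f) \<and>
             (\<Sum>\<^sub>\<infinity>j\<in>J. ip f (\<psi> j) * ip (\<psi> j) f) \<sqsubseteq>\<^sub>A \<beta> *\<^sub>R ip f f))"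

definition is_frame_operator ::
  "('a::cstar_algebra \<Rightarrow> 'h::banach \<Rightarrow> 'h) \<Rightarrow> ('h \<Rightarrow> 'h \<Rightarrow> 'a) \<Rightarrow> 'j set \<Rightarrow> ('j \<Rightarrow> 'h) \<Rightarrow> ('h \<Rightarrow> 'h) \<Rightarrow> bool"
  where
  "is_frame_operator act ip J \<psi> S \<longleftrightarrow>
     (\<forall>f. ((\<lambda>j. act (ip f (\<psi> j)) (\<psi> j)) has_sum S f) J)"

definition multiplier_converges ::
  "('a::cstar_algebra \<Rightarrow> 'h::banach \<Rightarrow> 'h) \<Rightarrow> ('h \<Rightarrow> 'h \<Rightarrow> 'a) \<Rightarrow> 'j set \<Rightarrow> ('j \<Rightarrow> 'a) \<Rightarrow> ('j \<Rightarrow> 'h) \<Rightarrow> bool"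
  where
  "multiplier_converges act ip J m \<psi> \<longleftrightarrow>
     (\<forall>f. (\<lambda>j. act (m j * ip f (\<psi> j)) (\<psi> j)) summable_on J)"

definition multiplier ::
  "('a::cstar_algebra \<Rightarrow> 'h::banach \<Rightarrow> 'h) \<Rightarrow> ('h \<Rightarrow> 'h \<Rightarrow> 'a) \<Rightarrow> 'j set \<Rightarrow> ('j \<Rightarrow> 'a) \<Rightarrow> ('j \<Rightarrow> 'h) \<Rightarrow> 'h \<Rightarrow> 'h"
  where
  "multiplier act ip J m \<psi> f = (\<Sum>\<^sub>\<infinity>j\<in>J. act (m j * ip f (\<psi> j)) (\<psi> j))"

definition semi_normalized :: "'j set \<Rightarrow> ('j \<Rightarrow> 'a::cstar_algebra) \<Rightarrow> bool" where
  "semi_normalized J c \<longleftrightarrow>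
     (\<exists>a b :: real. 0 < a \<and> a \<le> b \<and>
        (\<forall>j\<in>J. a *\<^sub>R 1 \<sqsubseteq>\<^sub>A cstar_abs (c j) \<and> cstar_abs (c j) \<sqsubseteq>\<^sub>A b *\<^sub>R 1))"

definition positive_seq :: "'j set \<Rightarrow> ('j \<Rightarrow> 'a::cstar_algebra) \<Rightarrow> bool" where
  "positive_seq J c \<longleftrightarrow> (\<forall>j\<in>J. 0 \<sqsubseteq>\<^sub>A c j)"

definition negative_seq :: "'j set \<Rightarrow> ('j \<Rightarrow> 'a::cstar_algebra) \<Rightarrow> bool" where
  "negative_seq J c \<longleftrightarrow> (\<forall>j\<in>J. 0 \<sqsubseteq>\<^sub>A - c j)"

end

theory Submission
  imports Defs
begin

text \<open>
  The multiplier is, term by term, the frame operator of \<open>sqrt (m j) \<cdot> \<psi> j\<close>, and this family is a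
  frame because \<open>a x x\<^sup>* \<le> x m\<^sub>j x\<^sup>* \<le> b x x\<^sup>*\<close> for \<open>x = \<langle>f, \<psi>\<^sub>j\<rangle>\<close>. A frame operator \<open>S\<close> converges by the
  \<open>A\<close>-valued Cauchy--Schwarz inequality, is self-adjoint, and satisfies \<open>\<alpha> \<le> S \<le> d\<close> for some
  \<open>d > \<alpha>\<close>; hence \<open>f \<mapsto> f - S f / d\<close> has norm at most \<open>1 - \<alpha> / d < 1\<close> and \<open>S\<close> is invertible by
  the contraction principle.

  The order of \<open>A\<close> is handled through the criterion that a self-adjoint \<open>x\<close> is positive iff
  \<open>\<parallel>t - x\<parallel> \<le> t\<close> for some real \<open>t\<close>. Together with the square root of \<open>1 - a\<close> for \<open>\<parallel>a\<parallel> \<le> 1\<close>, obtained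
  as the limit of an iteration, this replaces the spectral radius formula and the continuous
  functional calculus.
\<close>

section \<open>Positive elements of a C*-algebra\<close>

lemma star_0 [simp]: "star (0 :: 'a::cstar_algebra) = 0"
  by (metis add_cancel_right_right star_add)

lemma star_1 [simp]: "star (1 :: 'a::cstar_algebra) = 1"
  by (metis mult.right_neutral star_mult star_star)

lemma star_uminus: "star (- x) = - star (x :: 'a::cstar_algebra)"
  by (metis add.right_inverse add_eq_0_iff star_0 star_add)

lemma star_diff: "star (x - y) = star x - star (y :: 'a::cstar_algebra)"
  using star_add[of x "- y"] by (simp add: star_uminus)

lemma star_scaleR: "star (r *\<^sub>R x) = r *\<^sub>R star (x :: 'a::cstar_algebra)"
  by (metis complex_cnj_complex_of_real scaleC_of_real star_scaleC)

lemma star_sum: "star (sum f F) = (\<Sum>x\<in>F. star (f x :: 'a::cstar_algebra))"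
  by (induction F rule: infinite_finite_induct) (auto simp: star_add)

lemma scaleC_minus_left [simp]: "(- c) *\<^sub>C x = - (c *\<^sub>C (x :: 'a::cstar_algebra))"
  using scaleC_add_left[of c "- c" x] scaleC_of_real[of 0 x]
  by (simp add: eq_neg_iff_add_eq_0 add.commute)

lemma scaleC_minus_right [simp]: "c *\<^sub>C (- x) = - (c *\<^sub>C (x :: 'a::cstar_algebra))"
  using scaleC_add_right[of c x "- x"] scaleC_add_right[of c 0 0]
  by (metis add.commute add.right_inverse add_cancel_right_right eq_neg_iff_add_eq_0)

lemma scaleC_diff_right: "c *\<^sub>C (x - y) = c *\<^sub>C x - c *\<^sub>C (y :: 'a::cstar_algebra)"
  using scaleC_add_right[of c "x - y" y] by (simp add: algebra_simps)

lemma scaleC_diff_left: "(c - d) *\<^sub>C x = c *\<^sub>C x - d *\<^sub>C (x :: 'a::cstar_algebra)"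
  using scaleC_add_left[of c "- d" x] by simp

lemma scaleC_one [simp]: "1 *\<^sub>C x = (x :: 'a::cstar_algebra)"
  using scaleC_of_real[of 1 x] by simp

text \<open>The mixed terms cancel because \<open>h\<close> and \<open>k\<close> commute. Combined
  with the C*-identity this computes the norm of \<open>h + \<i> *\<^sub>C k\<close>;
  \<open>norm_square_bound\<close>, \<open>norm_pos_spectrum\<close> and
  \<open>norm_le_if_norm_pos\<close> rest on it.\<close>

lemma star_mult_self_cartesian:
  fixes h k :: "'a::cstar_algebra"
  assumes "star h = h" "star k = k" "h * k = k * h"
  shows "star (h + \<i> *\<^sub>C k) * (h + \<i> *\<^sub>C k) = h * h + k * k"
  using assms
  by (simp add: star_add star_scaleC)
     (simp add: algebra_simps scaleC_mult_left scaleC_mult_right scaleC_scaleC scaleC_add_right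
       scaleC_diff_right)

lemma norm_star [simp]: "norm (star x) = norm (x :: 'a::cstar_algebra)"
proof -
  have le: "norm x \<le> norm (star x)" for x :: 'a
  proof (cases "x = 0")
    case False
    have "norm x * norm x \<le> norm (star x) * norm x"
      using norm_mult_ineq[of "star x" x] by (simp add: cstar_identity power2_eq_square)
    with False show ?thesis by simp
  qed simp
  show ?thesis using le[of x] le[of "star x"] by (simp add: star_star)
qed

lemma bounded_linear_star: "bounded_linear (star :: 'a::cstar_algebra \<Rightarrow> 'a)"
  by (rule bounded_linear_intro[where K = 1]) (auto simp: star_add star_scaleR)

lemma cstar_identity': "norm (x * star x) = (norm (x :: 'a::cstar_algebra))\<^sup>2"
  using cstar_identity[of "star x"] by (simp add: star_star)

lemma norm_square_self_adjoint:
  "star x = x \<Longrightarrow> norm (x * x) = (norm (x :: 'a::cstar_algebra))\<^sup>2"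
  using cstar_identity[of x] by simp

lemma self_adjoint_square_eq_0: "star x = x \<Longrightarrow> x * x = 0 \<Longrightarrow> x = (0 :: 'a::cstar_algebra)"
  using norm_square_self_adjoint[of x] by simp

section \<open>Square root of \<open>1 - a\<close> by iteration\<close>

text \<open>A fixed point \<open>b\<close> of the recursion satisfies
  \<open>(1 - b) * (1 - b) = 1 - a\<close>. The type class includes the reals, where the iteration
  at \<open>a = 1\<close> serves as a scalar majorant.\<close>

primrec sqrt_iter :: "'a::real_normed_algebra_1 \<Rightarrow> nat \<Rightarrow> 'a" where
  "sqrt_iter a 0 = 0"
| "sqrt_iter a (Suc n) = (1/2) *\<^sub>R (a + sqrt_iter a n * sqrt_iter a n)"

lemma sqrt_iter_commute: "c * a = a * c \<Longrightarrow> c * sqrt_iter a n = sqrt_iter a n * c"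
  by (induction n) (auto simp: algebra_simps, metis mult.assoc)

lemma sqrt_iter_one: "0 \<le> sqrt_iter (1::real) n" "sqrt_iter (1::real) n \<le> 1"
  by (induction n) (auto simp: mult_le_one)

lemma norm_sqrt_iter: "norm a \<le> 1 \<Longrightarrow> norm (sqrt_iter a n) \<le> sqrt_iter 1 n"
proof (induction n)
  case (Suc n)
  have "norm (sqrt_iter a n * sqrt_iter a n) \<le> sqrt_iter 1 n * sqrt_iter 1 n"
    using Suc by (intro order_trans[OF norm_mult_ineq] mult_mono) (auto simp: sqrt_iter_one)
  then show ?case
    using Suc.prems norm_triangle_ineq[of a "sqrt_iter a n * sqrt_iter a n"] by simp
qed simp

text \<open>Consecutive iterates commute, so a difference of squares factors into sum times
  difference. The scalar iteration obeys the same recursion with equality. Domination by its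
  increments also covers \<open>norm a = 1\<close>, where the iteration need not be a
  contraction.\<close>

lemma norm_sqrt_iter_diff:
  assumes "norm a \<le> 1"
  shows "norm (sqrt_iter a (Suc n) - sqrt_iter a n) \<le> sqrt_iter 1 (Suc n) - sqrt_iter 1 n"
proof (induction n)
  case 0
  then show ?case using assms by simp
next
  case (Suc n)
  let ?s = "sqrt_iter a" and ?r = "sqrt_iter (1::real)"
  have comm: "?s (Suc n) * ?s n = ?s n * ?s (Suc n)"
    by (metis sqrt_iter_commute)
  have "?s (Suc (Suc n)) - ?s (Suc n) =
      (1/2) *\<^sub>R (?s (Suc n) * ?s (Suc n) - ?s n * ?s n)"
    by (simp only: sqrt_iter.simps(2)[of a "Suc n"] sqrt_iter.simps(2)[of a n])
       (simp add: algebra_simps)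
  also have "?s (Suc n) * ?s (Suc n) - ?s n * ?s n =
      (?s (Suc n) + ?s n) * (?s (Suc n) - ?s n)"
    using comm by (simp only: distrib_right right_diff_distrib) simp
  finally have "norm (?s (Suc (Suc n)) - ?s (Suc n)) =
      (1/2) * norm ((?s (Suc n) + ?s n) * (?s (Suc n) - ?s n))" by simp
  also have "\<dots> \<le> (1/2) * (norm (?s (Suc n) + ?s n) * norm (?s (Suc n) - ?s n))"
    by (intro mult_left_mono norm_mult_ineq) simp
  also have "\<dots> \<le> (1/2) * ((?r (Suc n) + ?r n) * (?r (Suc n) - ?r n))"
    using norm_triangle_mono[OF norm_sqrt_iter[OF assms] norm_sqrt_iter[OF assms]]
    by (intro mult_left_mono mult_mono Suc.IH) (auto intro: add_nonneg_nonneg sqrt_iter_one simp del: sqrt_iter.simps)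
  also have "\<dots> = ?r (Suc (Suc n)) - ?r (Suc n)"
    by (simp only: sqrt_iter.simps(2)[of 1 "Suc n"] sqrt_iter.simps(2)[of 1 n])
       (simp add: algebra_simps)
  finally show ?case .
qed

lemma sqrt_one_minus:
  fixes a :: "'a::cstar_algebra"
  assumes "norm a \<le> 1" and "star a = a"
  obtains b where "(1 - b) * (1 - b) = 1 - a" "norm b \<le> 1" "star b = b"
    "\<And>c. c * a = a * c \<Longrightarrow> c * b = b * c"
proof -
  let ?s = "sqrt_iter a" and ?r = "sqrt_iter (1::real)"
  have d: "norm (?s (Suc n) - ?s n) \<le> ?r (Suc n) - ?r n" for n
    by (rule norm_sqrt_iter_diff[OF assms(1)])
  \<comment> \<open>The scalar increments are nonnegative because by \<open>d\<close> they bound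
    norms.\<close>
  have "incseq ?r"
    using d by (intro incseq_SucI) (smt (verit) norm_ge_zero)
  then obtain L where "?r \<longlonglongrightarrow> L"
    using incseq_convergent[of ?r 1] sqrt_iter_one(2) by metis
  then have "summable (\<lambda>n. ?r (Suc n) - ?r n)"
    by (rule telescope_summable)
  then have "summable (\<lambda>n. ?s (Suc n) - ?s n)"
    by (rule summable_comparison_test'[of _ 0]) (rule d)
  then have "convergent (\<lambda>n. ?s n - ?s 0)"
    unfolding summable_iff_convergent sum_lessThan_telescope .
  then have "convergent ?s" by simp
  then obtain b where b: "?s \<longlonglongrightarrow> b" by (auto simp: convergent_def)
  have "(\<lambda>n. ?s (Suc n)) \<longlonglongrightarrow> (1/2) *\<^sub>R (a + b * b)"
    by (simp, intro tendsto_intros b)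
  then have eq: "b = (1/2) *\<^sub>R (a + b * b)"
    using LIMSEQ_unique LIMSEQ_Suc[OF b] by blast
  have "2 *\<^sub>R b = a + b * b"
    by (subst eq) simp
  then have "(1 - b) * (1 - b) = 1 - a"
    by (simp add: algebra_simps scaleR_2)
  moreover have "norm b \<le> 1"
    by (rule LIMSEQ_le_const2[OF tendsto_norm[OF b]])
       (meson norm_sqrt_iter[OF assms(1)] order_trans sqrt_iter_one(2))
  moreover have "star b = b"
  proof -
    have "star (?s n) = ?s n" for n
      by (induction n) (auto simp: star_scaleR star_add star_mult assms(2))
    moreover have "(\<lambda>n. star (?s n)) \<longlonglongrightarrow> star b"
      using b by (rule bounded_linear.tendsto[OF bounded_linear_star])
    ultimately show ?thesis using b LIMSEQ_unique by auto
  qed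
  moreover have "c * b = b * c" if "c * a = a * c" for c
  proof -
    have "(\<lambda>n. c * ?s n) \<longlonglongrightarrow> c * b" "(\<lambda>n. ?s n * c) \<longlonglongrightarrow> b * c"
      by (intro tendsto_intros b)+
    then show ?thesis using sqrt_iter_commute[OF that] LIMSEQ_unique by auto
  qed
  ultimately show ?thesis using that by blast
qed

section \<open>Positivity through the norm criterion\<close>

text \<open>The witness \<open>t\<close> is left open so that witnesses add up for sums; it is
  nonnegative, being above a norm. \<open>cstar_pos_iff_norm_pos\<close> identifies this notion with
  \<open>cstar_pos\<close>.\<close>

definition norm_pos :: "'a::cstar_algebra \<Rightarrow> bool" where
  "norm_pos x \<longleftrightarrow> star x = x \<and> (\<exists>t. norm (t *\<^sub>R 1 - x) \<le> t)"

lemma norm_pos_self_adjoint: "norm_pos x \<Longrightarrow> star x = x"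
  by (simp add: norm_pos_def)

lemma norm_pos_mono_bound:
  fixes x :: "'a::cstar_algebra"
  assumes "norm (t *\<^sub>R 1 - x) \<le> t" "t \<le> t'"
  shows "norm (t' *\<^sub>R 1 - x) \<le> t'"
proof -
  have "norm (t' *\<^sub>R 1 - x) \<le> norm ((t' - t) *\<^sub>R (1::'a)) + norm (t *\<^sub>R 1 - x)"
    by (rule order_trans[OF _ norm_triangle_ineq]) (simp add: algebra_simps)
  with assms show ?thesis by simp
qed

lemma norm_pos_add:
  fixes x :: "'a::cstar_algebra"
  assumes "norm_pos x" "norm_pos y"
  shows "norm_pos (x + y)"
proof -
  obtain t u where "norm (t *\<^sub>R 1 - x) \<le> t" "norm (u *\<^sub>R 1 - y) \<le> u"
    using assms by (auto simp: norm_pos_def)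
  then have "norm ((t + u) *\<^sub>R 1 - (x + y)) \<le> t + u"
    using norm_triangle_ineq[of "t *\<^sub>R 1 - x" "u *\<^sub>R 1 - y"] by (simp add: algebra_simps)
  then show ?thesis using assms by (auto simp: norm_pos_def star_add)
qed

lemma norm_pos_of_real: "0 \<le> r \<Longrightarrow> norm_pos (r *\<^sub>R 1 :: 'a::cstar_algebra)"
  by (auto simp: norm_pos_def star_scaleR intro!: exI[of _ r])

lemma norm_pos_scaleR:
  fixes x :: "'a::cstar_algebra"
  assumes "norm_pos x" "0 \<le> r"
  shows "norm_pos (r *\<^sub>R x)"
proof -
  obtain t where "norm (t *\<^sub>R 1 - x) \<le> t" using assms by (auto simp: norm_pos_def)
  then have "norm (r *\<^sub>R (t *\<^sub>R 1 - x)) \<le> r * t" using assms by (simp add: mult_left_mono)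
  then have "norm ((r * t) *\<^sub>R 1 - r *\<^sub>R x) \<le> r * t" by (simp add: algebra_simps)
  then show ?thesis using assms by (auto simp: norm_pos_def star_scaleR)
qed

text \<open>After division by a witness, \<open>x\<close> becomes \<open>1 - a\<close> with
  \<open>norm a \<le> 1\<close>, and \<open>sqrt_one_minus\<close> applies. The commutation clause
  makes roots of commuting elements commute.\<close>

lemma norm_pos_sqrt:
  fixes x :: "'a::cstar_algebra"
  assumes "norm_pos x"
  obtains q where "norm_pos q" "q * q = x" "\<And>c. c * x = x * c \<Longrightarrow> c * q = q * c"
proof -
  obtain t where t: "norm (t *\<^sub>R 1 - x) \<le> t" using assms by (auto simp: norm_pos_def)
  \<comment> \<open>The witness may be 0, and it is about to be divided by.\<close>
  define t' where "t' = max t 1"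
  have t': "norm (t' *\<^sub>R 1 - x) \<le> t'" "t' > 0"
    using norm_pos_mono_bound[OF t] by (auto simp: t'_def)
  define a where "a = 1 - (1/t') *\<^sub>R x"
  have x: "x = t' *\<^sub>R (1 - a)" using t' by (simp add: a_def)
  have "a = (1/t') *\<^sub>R (t' *\<^sub>R 1 - x)" using t' by (simp add: a_def algebra_simps)
  then have "norm a = norm (t' *\<^sub>R 1 - x) / t'" using t' by simp
  then have "norm a \<le> 1" using t' by (metis divide_le_eq_1_pos)
  moreover have "star a = a"
    using norm_pos_self_adjoint[OF assms] by (simp add: a_def star_diff star_scaleR)
  ultimately obtain b where b: "(1 - b) * (1 - b) = 1 - a" "norm b \<le> 1" "star b = b"
    and comm: "\<And>c. c * a = a * c \<Longrightarrow> c * b = b * c"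
    using sqrt_one_minus by blast
  have "norm_pos (1 - b)"
    using b by (auto simp: norm_pos_def star_diff intro!: exI[of _ 1])
  then have "norm_pos (sqrt t' *\<^sub>R (1 - b))" using t' by (intro norm_pos_scaleR) auto
  moreover have "(sqrt t' *\<^sub>R (1 - b)) * (sqrt t' *\<^sub>R (1 - b)) = x"
    using t' b(1) by (simp add: x)
  moreover have "c * (sqrt t' *\<^sub>R (1 - b)) = (sqrt t' *\<^sub>R (1 - b)) * c" if "c * x = x * c" for c
  proof -
    have "c * a = a * c" using that by (simp add: a_def algebra_simps)
    then show ?thesis using comm by (simp add: algebra_simps)
  qed
  ultimately show ?thesis using that by blast
qed

text \<open>Write \<open>h\<close> as the real part of the unitary \<open>u = h + \<i> sqrt (1 - h\<^sup>2)\<close>; then \<open>2 h\<^sup>2 - 1\<close> is the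
  real part of \<open>u\<^sup>2\<close>.\<close>

lemma norm_square_bound:
  fixes h :: "'a::cstar_algebra"
  assumes "star h = h" "norm h \<le> 1"
  shows "norm (2 *\<^sub>R (h * h) - 1) \<le> 1"
proof -
  have "norm (h * h) \<le> 1"
    using assms by (simp add: norm_square_self_adjoint power_le_one)
  then obtain b where b: "(1 - b) * (1 - b) = 1 - h * h" "star b = b"
    and comm: "\<And>c. c * (h * h) = (h * h) * c \<Longrightarrow> c * b = b * c"
    using sqrt_one_minus[of "h * h"] assms by (metis star_mult)
  define s where "s = 1 - b"
  have s: "s * s = 1 - h * h" "star s = s" using b by (auto simp: s_def star_diff)
  have hs: "h * s = s * h" using comm[of h] by (simp add: s_def algebra_simps)
  define u where "u = h + \<i> *\<^sub>C s"
  have su: "star u = h - \<i> *\<^sub>C s"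
    by (simp add: u_def star_add star_scaleC s assms)
  have "star u * u = 1"
    using star_mult_self_cartesian[OF assms(1) s(2) hs] s(1) by (simp add: u_def)
  then have nu: "norm u = 1"
    using cstar_identity[of u] power2_eq_iff_nonneg[of "norm u" 1] by simp
  have "norm (u * u) \<le> 1" "norm (star u * star u) \<le> 1"
    using norm_mult_ineq[of u u] norm_mult_ineq[of "star u" "star u"] nu by simp_all
  moreover have "u * u + star u * star u = 2 *\<^sub>R (2 *\<^sub>R (h * h) - 1)"
    using s(1) hs
    by (simp add: su) (simp add: u_def algebra_simps scaleC_mult_left scaleC_mult_right scaleC_scaleC scaleC_add_right
          scaleC_diff_right scaleR_2)
  ultimately have "norm (2 *\<^sub>R (2 *\<^sub>R (h * h) - 1)) \<le> 2"
    using norm_triangle_mono[of "u * u" 1 "star u * star u" 1] by simp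
  then show ?thesis by simp
qed

text \<open>Rescaling of \<open>norm_square_bound\<close>. The bound places \<open>h * h\<close> in
  the ball whose centre and radius are both \<open>norm (h * h) / 2\<close>; this sharp radius is
  what \<open>norm_pos_antisym\<close> needs.\<close>

lemma norm_bound_of_square:
  fixes h :: "'a::cstar_algebra"
  assumes "star h = h"
  shows "norm (norm (h * h) *\<^sub>R 1 - 2 *\<^sub>R (h * h)) \<le> norm (h * h)"
proof (cases "h = 0")
  case False
  define k where "k = (1 / norm h) *\<^sub>R h"
  have "norm (2 *\<^sub>R (k * k) - 1) \<le> 1"
    using assms False by (intro norm_square_bound) (auto simp: k_def star_scaleR)
  moreover have n: "norm (h * h) = norm h * norm h"
    using norm_square_self_adjoint[OF assms] by (simp add: power2_eq_square)
  then have "norm (h * h) *\<^sub>R 1 - 2 *\<^sub>R (h * h) = norm (h * h) *\<^sub>R - (2 *\<^sub>R (k * k) - 1)"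
    using False by (simp add: k_def algebra_simps)
  ultimately show ?thesis
    using mult_left_mono[of "norm (2 *\<^sub>R (k * k) - 1)" 1 "norm (h * h)"]
    by (simp add: norm_minus_commute)
qed simp

lemma norm_pos_bound2: "norm_pos x \<Longrightarrow> norm (norm x *\<^sub>R 1 - 2 *\<^sub>R x) \<le> norm x"
  by (metis norm_bound_of_square norm_pos_self_adjoint norm_pos_sqrt)

lemma norm_pos_square:
  fixes h :: "'a::cstar_algebra"
  assumes "star h = h"
  shows "norm_pos (h * h)"
proof -
  have "norm (norm (h * h) *\<^sub>R 1 - 2 *\<^sub>R (h * h)) \<le> norm (h * h)"
    by (rule norm_bound_of_square[OF assms])
  then have "norm_pos (2 *\<^sub>R (h * h))"
    using assms by (auto simp: norm_pos_def star_scaleR star_mult)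
  from norm_pos_scaleR[OF this, of "1/2"] show ?thesis by simp
qed

lemma norm_pos_bound: "norm_pos (x :: 'a::cstar_algebra) \<Longrightarrow> norm (norm x *\<^sub>R 1 - x) \<le> norm x"
proof -
  assume "norm_pos x"
  then have "norm (norm x *\<^sub>R 1 - 2 *\<^sub>R x) \<le> norm x" by (rule norm_pos_bound2)
  moreover have "2 *\<^sub>R (norm x *\<^sub>R 1 - x) = (norm x *\<^sub>R 1 - 2 *\<^sub>R x) + norm x *\<^sub>R 1"
    using scaleR_2[of "norm x *\<^sub>R (1::'a)"] by (simp add: scaleR_right_diff_distrib diff_add_eq)
  then have "norm (2 *\<^sub>R (norm x *\<^sub>R 1 - x)) \<le> norm (norm x *\<^sub>R 1 - 2 *\<^sub>R x) + norm x"
    by (metis norm_triangle_ineq norm_scaleR norm_one abs_norm_cancel mult.right_neutral)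
  ultimately show ?thesis by simp
qed

text \<open>The sharp bounds for \<open>x\<close> and \<open>- x\<close> give
  \<open>4 * norm x \<le> 2 * norm x\<close>.\<close>

lemma norm_pos_antisym:
  fixes x :: "'a::cstar_algebra"
  assumes "norm_pos x" "norm_pos (- x)"
  shows "x = 0"
proof -
  have bounds: "norm (norm x *\<^sub>R 1 + 2 *\<^sub>R x) \<le> norm x" "norm (norm x *\<^sub>R 1 - 2 *\<^sub>R x) \<le> norm x"
    using assms[THEN norm_pos_bound2] by simp_all
  have eq: "4 *\<^sub>R x = (norm x *\<^sub>R 1 + 2 *\<^sub>R x) - (norm x *\<^sub>R 1 - 2 *\<^sub>R x)"
    by (simp flip: scaleR_left_distrib)
  have "norm (4 *\<^sub>R x) \<le> norm x + norm x"
    unfolding eq by (rule order_trans[OF norm_triangle_ineq4 add_mono]) (fact bounds)+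
  then show ?thesis by simp
qed

text \<open>Arbitrary witnesses could diverge along the filter, but by \<open>norm_pos_bound\<close>
  the norm is always a witness, and it converges.\<close>

lemma norm_pos_tendsto:
  fixes x :: "'a::cstar_algebra"
  assumes "(f \<longlongrightarrow> x) F" "F \<noteq> bot" "eventually (\<lambda>i. norm_pos (f i)) F"
  shows "norm_pos x"
proof -
  have "((\<lambda>i. star (f i)) \<longlongrightarrow> star x) F"
    using assms(1) by (rule bounded_linear.tendsto[OF bounded_linear_star])
  moreover have "((\<lambda>i. star (f i)) \<longlongrightarrow> x) F"
    using assms(1) by (rule Lim_transform_eventually)
      (use assms(3) in eventually_elim, simp add: norm_pos_self_adjoint)
  ultimately have "star x = x" using tendsto_unique assms(2) by blast
  moreover have "norm (norm x *\<^sub>R 1 - x) \<le> norm x"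
  proof (rule tendsto_le[OF assms(2)])
    show "((\<lambda>i. norm (f i)) \<longlongrightarrow> norm x) F"
      "((\<lambda>i. norm (norm (f i) *\<^sub>R 1 - f i)) \<longlongrightarrow> norm (norm x *\<^sub>R 1 - x)) F"
      by (intro tendsto_intros assms(1))+
    show "eventually (\<lambda>i. norm (norm (f i) *\<^sub>R 1 - f i) \<le> norm (f i)) F"
      using assms(3) by eventually_elim (rule norm_pos_bound)
  qed
  ultimately show ?thesis by (auto simp: norm_pos_def)
qed

section \<open>Agreement with the spectral definition of positivity\<close>

lemma alg_invertible_one_minus:
  fixes a :: "'a::cstar_algebra"
  assumes "norm a < 1"
  shows "alg_invertible (1 - a)"
proof -
  have s: "summable (\<lambda>n. a ^ n)"
    using assms by (rule complete_algebra_summable_geometric)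
  let ?y = "\<Sum>n. a ^ n"
  have y: "?y = 1 + (\<Sum>n. a ^ Suc n)"
    using suminf_split_head[OF s] by simp
  have "?y = 1 + a * ?y"
    using y suminf_mult[OF s, of a] by simp
  moreover have "?y = 1 + ?y * a"
    using y suminf_mult2[OF s, of a] by (simp add: power_commutes)
  ultimately have "(1 - a) * ?y = 1" "?y * (1 - a) = 1"
    by (simp_all add: algebra_simps)
  then show ?thesis by (auto simp: alg_invertible_def)
qed

lemma alg_invertible_scaleC:
  fixes x :: "'a::cstar_algebra"
  assumes "alg_invertible x" "c \<noteq> 0"
  shows "alg_invertible (c *\<^sub>C x)"
proof -
  obtain y where "x * y = 1" "y * x = 1" using assms by (auto simp: alg_invertible_def)
  then show ?thesis using assms(2) unfolding alg_invertible_def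
    by (intro exI[of _ "(1/c) *\<^sub>C y"]) (simp add: scaleC_mult_left scaleC_mult_right scaleC_scaleC)
qed

lemma alg_invertible_scaleR:
  "alg_invertible (x :: 'a::cstar_algebra) \<Longrightarrow> c \<noteq> 0 \<Longrightarrow> alg_invertible (c *\<^sub>R x)"
  using alg_invertible_scaleC[of x "complex_of_real c"] by (simp add: scaleC_of_real)

text \<open>If \<open>y\<close> inverts \<open>1 - a * b\<close>, then \<open>1 + b * y * a\<close>
  inverts \<open>1 - b * a\<close>.\<close>

lemma alg_invertible_one_minus_swap:
  fixes a b :: "'a::cstar_algebra"
  assumes "alg_invertible (1 - a * b)"
  shows "alg_invertible (1 - b * a)"
proof -
  obtain y where y: "(1 - a * b) * y = 1" "y * (1 - a * b) = 1"
    using assms by (auto simp: alg_invertible_def)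
  have "(1 - b * a) * (1 + b * y * a) = 1 - b * a + b * ((1 - a * b) * y) * a"
    "(1 + b * y * a) * (1 - b * a) = 1 - b * a + b * (y * (1 - a * b)) * a"
    by (simp_all add: algebra_simps)
  then show ?thesis unfolding y by (auto simp: alg_invertible_def)
qed

text \<open>If \<open>z\<close> were farther from \<open>w\<close>, then \<open>x - z\<close> would
  be a nonzero multiple of \<open>1 - (x - w) / (z - w)\<close>, which the Neumann series
  inverts.\<close>

lemma cmod_diff_le_of_spectrum:
  fixes x :: "'a::cstar_algebra"
  assumes "z \<in> alg_spectrum x"
  shows "cmod (z - w) \<le> norm (x - w *\<^sub>C 1)"
proof (rule ccontr)
  assume less: "\<not> ?thesis"
  then have nz: "z - w \<noteq> 0" by auto
  have "norm ((1 / (z - w)) *\<^sub>C (x - w *\<^sub>C 1)) = norm (x - w *\<^sub>C 1) / cmod (z - w)"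
    by (simp add: norm_scaleC norm_divide)
  also have "\<dots> < 1" using less nz by (simp add: divide_less_eq)
  finally have "alg_invertible ((- (z - w)) *\<^sub>C (1 - (1 / (z - w)) *\<^sub>C (x - w *\<^sub>C 1)))"
    using nz by (intro alg_invertible_scaleC alg_invertible_one_minus) auto
  also have "(- (z - w)) *\<^sub>C (1 - (1 / (z - w)) *\<^sub>C (x - w *\<^sub>C 1)) = x - z *\<^sub>C 1"
    using nz by (simp add: scaleC_diff_right scaleC_diff_left scaleC_scaleC
        del: scaleC_minus_left minus_diff_eq) (simp add: scaleC_diff_left)
  finally show False using assms by (simp add: alg_spectrum_def)
qed

text \<open>Comparing distances from \<open>z\<close> and from \<open>x\<close> to the points \<open>t + \<i> \<tau>\<close> for all real \<open>\<tau>\<close> shows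
  that \<open>z\<close> is real; the point \<open>t\<close> then shows that \<open>z \<ge> 0\<close>.\<close>

lemma norm_pos_spectrum:
  fixes x :: "'a::cstar_algebra"
  assumes "norm_pos x"
  shows "alg_spectrum x \<subseteq> complex_of_real ` {0..}"
proof
  fix z assume z: "z \<in> alg_spectrum x"
  obtain t where t: "norm (t *\<^sub>R 1 - x) \<le> t" using assms by (auto simp: norm_pos_def)
  then have t': "norm (x - t *\<^sub>R 1) \<le> t" "0 \<le> t"
    by (auto simp: norm_minus_commute) (metis norm_ge_zero order_trans)
  have x: "star (x - t *\<^sub>R 1) = x - t *\<^sub>R 1"
    using norm_pos_self_adjoint[OF assms] by (simp add: star_diff star_scaleR)
  \<comment> \<open>Since \<open>?h\<close> is self-adjoint and \<open>?k\<close> is real, the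
    C*-identity makes \<open>\<tau>\<close> contribute just its square on the right, whereas on the
    left it is shifted by \<open>Im z\<close>.\<close>
  have bound: "(Re z - t)\<^sup>2 + (Im z - \<tau>)\<^sup>2 \<le> t\<^sup>2 + \<tau>\<^sup>2" for \<tau>
  proof -
    let ?h = "x - t *\<^sub>R 1" and ?k = "(- \<tau>) *\<^sub>R (1 :: 'a)"
    have v: "x - Complex t \<tau> *\<^sub>C 1 = ?h + \<i> *\<^sub>C ?k"
      by (simp add: Complex_eq scaleC_add_left scaleC_of_real scaleC_diff_left mult.commute
          flip: scaleC_scaleC scaleC_of_real)
    have "(cmod (z - Complex t \<tau>))\<^sup>2 \<le> (norm (?h + \<i> *\<^sub>C ?k))\<^sup>2"
      unfolding v[symmetric] by (intro power_mono cmod_diff_le_of_spectrum z) simp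
    also have "\<dots> = norm (?h * ?h + ?k * ?k)"
      unfolding cstar_identity[symmetric]
      by (subst star_mult_self_cartesian) (use x in \<open>auto simp: star_scaleR star_uminus\<close>)
    also have "\<dots> \<le> norm (?h * ?h) + norm (?k * ?k)" by (rule norm_triangle_ineq)
    also have "norm (?h * ?h) \<le> t\<^sup>2"
      using t' by (simp add: norm_square_self_adjoint[OF x] power_mono)
    finally show ?thesis by (simp add: cmod_power2) (simp add: power2_eq_square)
  qed
  have im: "Im z = 0"
  proof (rule ccontr)
    assume nz: "Im z \<noteq> 0"
    \<comment> \<open>Chosen so that the cross term \<open>- 2 * Im z * \<tau>\<close> equals
      \<open>t^2 + 1\<close>, which exceeds what \<open>bound\<close> allows.\<close>
    define \<tau> where "\<tau> = - (t\<^sup>2 + 1) / (2 * Im z)"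
    have "2 * Im z * \<tau> = - (t\<^sup>2 + 1)" using nz by (simp add: \<tau>_def)
    moreover have "(Im z - \<tau>)\<^sup>2 = (Im z)\<^sup>2 - 2 * Im z * \<tau> + \<tau>\<^sup>2"
      by (simp add: power2_diff)
    ultimately show False
      using bound[of \<tau>] zero_le_power2[of "Re z - t"] zero_le_power2[of "Im z"] by linarith
  qed
  have "(Re z - t)\<^sup>2 \<le> t\<^sup>2" using bound[of 0] im by simp
  then have "\<bar>Re z - t\<bar> \<le> t" using t'(2) by (simp add: power2_le_iff_abs_le)
  then have "0 \<le> Re z" by linarith
  moreover have "z = complex_of_real (Re z)" using im by (simp add: complex_eq_iff)
  ultimately show "z \<in> complex_of_real ` {0..}" by blast
qed

text \<open>The least \<open>l \<ge> 0\<close> with \<open>x + l\<close> positive is \<open>0\<close>: otherwise \<open>p = x + l\<close> is invertible, and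
  \<open>p - \<epsilon> = p (1 - \<epsilon> p\<^sup>-\<^sup>1)\<close> is still a square for small \<open>\<epsilon> > 0\<close>.\<close>

lemma norm_posI_invertible:
  fixes x :: "'a::cstar_algebra"
  assumes sa: "star x = x" and inv: "\<And>l. l > 0 \<Longrightarrow> alg_invertible (x + l *\<^sub>R 1)"
  shows "norm_pos x"
proof -
  define S where "S = {l. 0 \<le> l \<and> norm_pos (x + l *\<^sub>R 1)}"
  have "norm x \<in> S"
    using sa by (auto simp: S_def norm_pos_def star_add star_scaleR intro!: exI[of _ "norm x"])
  then have ne: "S \<noteq> {}" by blast
  have bdd: "bdd_below S" by (auto simp: S_def intro!: bdd_belowI[of _ 0])
  have "closed S"
    unfolding closed_sequential_limits
  proof (intro allI impI, elim conjE)
    fix f l assume f: "\<forall>n. f n \<in> S" "f \<longlonglongrightarrow> l"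
    then have "0 \<le> l" by (intro LIMSEQ_le_const[of f]) (auto simp: S_def)
    moreover have "norm_pos (x + l *\<^sub>R 1)"
      by (rule norm_pos_tendsto[of "\<lambda>n. x + f n *\<^sub>R 1" _ sequentially])
         (use f in \<open>auto simp: S_def intro!: tendsto_intros\<close>)
    ultimately show "l \<in> S" by (simp add: S_def)
  qed
  define l where "l = Inf S"
  have "l \<in> S" unfolding l_def using ne bdd \<open>closed S\<close> by (rule closed_contains_Inf)
  then have l: "0 \<le> l" "norm_pos (x + l *\<^sub>R 1)" by (auto simp: S_def)
  have "\<not> 0 < l"
  proof
    assume "0 < l"
    define p where "p = x + l *\<^sub>R 1"
    obtain y where y: "p * y = 1" "y * p = 1"
      using inv[OF \<open>0 < l\<close>] by (auto simp: alg_invertible_def p_def)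
    have p: "norm_pos p" "star p = p" using l norm_pos_self_adjoint by (auto simp: p_def)
    have "star y * p = 1" using arg_cong[OF y(1), of star] p by (simp add: star_mult)
    then have sy: "star y = y" by (metis y(1) mult.assoc mult.left_neutral mult.right_neutral)
    have ny: "norm y > 0" using y(1) by auto
    \<comment> \<open>The bound by \<open>1 / norm y\<close> makes
      \<open>1 - \<epsilon> *\<^sub>R y\<close> positive with witness 1; the bound by
      \<open>l\<close> keeps \<open>l - \<epsilon>\<close> nonnegative.\<close>
    define \<epsilon> where "\<epsilon> = min l (1 / norm y)"
    have e: "0 < \<epsilon>" "\<epsilon> \<le> l" "\<epsilon> \<le> 1 / norm y" using \<open>0 < l\<close> ny by (auto simp: \<epsilon>_def)
    have "\<epsilon> * norm y \<le> 1" using e(3) ny by (simp add: pos_le_divide_eq)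
    then have "norm_pos (1 - \<epsilon> *\<^sub>R y)"
      using e(1) by (auto simp: norm_pos_def star_diff star_scaleR sy intro!: exI[of _ 1])
    then obtain s where s: "norm_pos s" "s * s = 1 - \<epsilon> *\<^sub>R y"
      and s_comm: "\<And>c. c * (1 - \<epsilon> *\<^sub>R y) = (1 - \<epsilon> *\<^sub>R y) * c \<Longrightarrow> c * s = s * c"
      using norm_pos_sqrt by blast
    obtain q where q: "norm_pos q" "q * q = p" and q_comm: "\<And>c. c * p = p * c \<Longrightarrow> c * q = q * c"
      using norm_pos_sqrt p(1) by blast
    \<comment> \<open>\<open>p\<close> commutes with its inverse \<open>y\<close>, hence with
      \<open>s\<close>, and then \<open>s\<close> commutes with \<open>q\<close>. So
      \<open>q * s\<close> is self-adjoint and its square is \<open>p - \<epsilon>\<close>.\<close>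
    have "p * s = s * p" using y by (intro s_comm) (simp add: algebra_simps)
    then have sq: "s * q = q * s" using q_comm[of s] by simp
    have "(q * s) * (q * s) = (q * q) * (s * s)" using sq by (metis mult.assoc)
    also have "\<dots> = x + (l - \<epsilon>) *\<^sub>R 1"
      using y by (simp add: q s right_diff_distrib) (simp add: p_def algebra_simps)
    finally have "(q * s) * (q * s) = x + (l - \<epsilon>) *\<^sub>R 1" .
    moreover have "star (q * s) = q * s"
      using sq norm_pos_self_adjoint[OF q(1)] norm_pos_self_adjoint[OF s(1)] by (simp add: star_mult)
    ultimately have "norm_pos (x + (l - \<epsilon>) *\<^sub>R 1)" using norm_pos_square by metis
    then have "l - \<epsilon> \<in> S" using e by (simp add: S_def)
    then have "l \<le> l - \<epsilon>" unfolding l_def using bdd by (rule cInf_lower)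
    then show False using e by simp
  qed
  with l show ?thesis by simp
qed

lemma cstar_pos_invertible:
  fixes x :: "'a::cstar_algebra"
  assumes "cstar_pos x" "l > 0"
  shows "alg_invertible (x + l *\<^sub>R 1)"
proof -
  have "complex_of_real (- l) \<notin> alg_spectrum x"
    using assms by (auto simp: cstar_pos_def simp flip: of_real_minus)
  then show ?thesis by (simp add: alg_spectrum_def scaleC_of_real)
qed

lemma cstar_pos_iff_norm_pos: "cstar_pos x \<longleftrightarrow> norm_pos x"
  using norm_pos_spectrum norm_pos_self_adjoint norm_posI_invertible cstar_pos_invertible
  by (metis cstar_pos_def)

section \<open>Positivity of \<open>x * star x\<close> and its consequences\<close>

text \<open>For \<open>l > 0\<close>, invertibility passes from \<open>a * b + l\<close> to
  \<open>b * a + l\<close> by \<open>alg_invertible_one_minus_swap\<close>, and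
  \<open>norm_posI_invertible\<close> turns this into positivity.\<close>

lemma norm_pos_swap:
  fixes a b :: "'a::cstar_algebra"
  assumes "norm_pos (a * b)" "star (b * a) = b * a"
  shows "norm_pos (b * a)"
proof (rule norm_posI_invertible[OF assms(2)])
  fix l :: real assume l: "l > 0"
  have eq: "u * v + l *\<^sub>R 1 = l *\<^sub>R (1 - u * ((- 1 / l) *\<^sub>R v))" "1 - u * ((- 1 / l) *\<^sub>R v) = 1 - ((- 1 / l) *\<^sub>R u) * v"
    for u v :: 'a using l by (auto simp: algebra_simps)
  have "alg_invertible ((1/l) *\<^sub>R (a * b + l *\<^sub>R 1))"
    using assms(1) l by (intro alg_invertible_scaleR cstar_pos_invertible)
      (auto simp: cstar_pos_iff_norm_pos)
  then have "alg_invertible (1 - a * ((- 1 / l) *\<^sub>R b))"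
    unfolding eq using l by simp
  then have "alg_invertible (1 - ((- 1 / l) *\<^sub>R b) * a)" by (rule alg_invertible_one_minus_swap)
  then have "alg_invertible (l *\<^sub>R (1 - b * ((- 1 / l) *\<^sub>R a)))"
    using l by (intro alg_invertible_scaleR) (auto simp: eq(2))
  then show "alg_invertible (b * a + l *\<^sub>R 1)" by (simp only: eq(1))
qed

text \<open>Up to the factor 2 this is the sum of the squares of the self-adjoint elements
  \<open>t + star t\<close> and \<open>\<i> *\<^sub>C (t - star t)\<close>.\<close>

lemma norm_pos_star_mult_add: "norm_pos (t * star t + star t * (t :: 'a::cstar_algebra))"
proof -
  let ?h = "t + star t" and ?k = "\<i> *\<^sub>C (t - star t)"
  have "norm_pos ((1/2) *\<^sub>R (?h * ?h + ?k * ?k))"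
    by (intro norm_pos_scaleR norm_pos_add norm_pos_square)
       (auto simp: star_add star_diff star_scaleC star_star scaleC_diff_right add.commute)
  moreover have "(1/2) *\<^sub>R (?h * ?h + ?k * ?k) = (1/2) *\<^sub>R (2 *\<^sub>R (t * star t + star t * t))"
    by (intro arg_cong[where f = "scaleR _"])
      (simp add: scaleC_mult_left scaleC_mult_right scaleC_scaleC scaleC_diff_right
        algebra_simps scaleR_2)
  ultimately show ?thesis by simp
qed

text \<open>Let \<open>y = x x\<^sup>*\<close>, \<open>b = \<bar>y\<bar> - y\<close> and \<open>t = b x\<close>. Then \<open>- t t\<^sup>* = \<bar>y\<bar> b\<^sup>2\<close> is positive, hence so is
  \<open>- t\<^sup>* t\<close>; since \<open>t t\<^sup>* + t\<^sup>* t\<close> is positive as well, \<open>t = 0\<close>, which forces \<open>y = \<bar>y\<bar>\<close>.\<close>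

lemma norm_pos_mult_star: "norm_pos (x * star (x :: 'a::cstar_algebra))"
proof -
  define y where "y = x * star x"
  have sy: "star y = y" by (simp add: y_def star_mult star_star)
  obtain q where q: "norm_pos q" "q * q = y * y"
    and q_comm: "\<And>c. c * (y * y) = (y * y) * c \<Longrightarrow> c * q = q * c"
    using norm_pos_sqrt norm_pos_square[OF sy] by blast
  \<comment> \<open>\<open>q\<close> is the absolute value of \<open>y\<close>; its root
    \<open>h\<close> turns \<open>q * b * b\<close> into the square of the self-adjoint
    \<open>h * b\<close>.\<close>
  obtain h where h: "norm_pos h" "h * h = q" and h_comm: "\<And>c. c * q = q * c \<Longrightarrow> c * h = h * c"
    using norm_pos_sqrt q(1) by blast
  have yq: "y * q = q * y" using q_comm[of y] by (simp add: mult.assoc)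
  define b where "b = q - y"
  have bq: "b * q = q * b" and b_y: "b * y = - (q * b)" and yb: "y * b = - (q * b)"
    using yq q(2) by (simp_all add: b_def algebra_simps)
  have sb: "star b = b" using sy norm_pos_self_adjoint[OF q(1)] by (simp add: b_def star_diff)
  have bh: "b * h = h * b" using h_comm bq by blast
  define t where "t = b * x"
  have "t * star t = (b * y) * b"
    by (simp add: t_def star_mult sb y_def mult.assoc)
  also have "\<dots> = - ((h * b) * (h * b))"
    unfolding b_y h(2)[symmetric] using bh by (metis mult.assoc mult_minus_left)
  finally have tt: "t * star t = - ((h * b) * (h * b))" .
  have shb: "star (h * b) = h * b"
    using bh sb norm_pos_self_adjoint[OF h(1)] by (simp add: star_mult)
  have pos: "norm_pos (- (t * star t))" using norm_pos_square[OF shb] by (simp add: tt)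
  then have "norm_pos (- (star t * t))"
    using norm_pos_swap[of "- t" "star t"] by (simp add: star_mult star_star star_uminus)
  then have "norm_pos (t * star t)"
    using norm_pos_add[OF norm_pos_star_mult_add[of t]] by fastforce
  then have "t * star t = 0" using pos norm_pos_antisym by blast
  then have "h * b = 0" using self_adjoint_square_eq_0[OF shb] tt by simp
  then have "q * b = 0" using h(2) by (metis mult.assoc mult_zero_right)
  then have "b * b = 0" using yb by (simp add: b_def left_diff_distrib)
  then have "b = 0" using self_adjoint_square_eq_0[OF sb] by simp
  then show ?thesis using q(1) by (simp add: b_def y_def)
qed

text \<open>With \<open>q * q = p\<close> the product is
  \<open>(a * q) * star (a * q)\<close>.\<close>

lemma norm_pos_congruence:
  fixes p :: "'a::cstar_algebra"
  assumes "norm_pos p"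
  shows "norm_pos (a * p * star a)"
proof -
  obtain q where q: "norm_pos q" "q * q = p" using norm_pos_sqrt assms by blast
  then have "a * p * star a = (a * q) * star (a * q)"
    by (simp add: star_mult norm_pos_self_adjoint flip: q(2)) (simp add: mult.assoc)
  then show ?thesis using norm_pos_mult_star by metis
qed

text \<open>Two given roots are not known to commute, so each root \<open>w\<close> is compared with
  the root \<open>q\<close> from \<open>norm_pos_sqrt\<close>, which does commute with it. For
  \<open>d = w - q\<close> the positive elements \<open>d * w * d\<close> and
  \<open>d * q * d\<close> are negatives of each other, so both vanish; then the cube of
  \<open>d\<close> is 0, and so is \<open>d\<close>.\<close>

lemma norm_pos_sqrt_unique:
  fixes y :: "'a::cstar_algebra"
  assumes "norm_pos y" "norm_pos z" "y * y = z * z"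
  shows "y = z"
proof -
  have "norm_pos (y * y)" using assms(1) by (simp add: norm_pos_square norm_pos_self_adjoint)
  then obtain q where q: "norm_pos q" "q * q = y * y"
    and comm: "\<And>c. c * (y * y) = (y * y) * c \<Longrightarrow> c * q = q * c"
    using norm_pos_sqrt by blast
  have uniq: "w = q" if w: "norm_pos w" "w * w = y * y" for w
  proof -
    have "w * (y * y) = (y * y) * w" by (metis mult.assoc w(2))
    then have wq: "w * q = q * w" by (rule comm)
    define d where "d = w - q"
    have sd: "star d = d"
      using w(1) q(1) by (simp add: d_def star_diff norm_pos_self_adjoint)
    have "d * (w + q) = 0" using w q wq by (simp add: d_def algebra_simps)
    then have eq: "d * q * d = - (d * w * d)"
      by (simp add: distrib_left eq_neg_iff_add_eq_0 flip: distrib_right) (simp add: add.commute flip: distrib_right)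
    have "norm_pos (d * w * d)" "norm_pos (d * q * d)"
      using norm_pos_congruence[OF w(1), of d] norm_pos_congruence[OF q(1), of d] sd by auto
    then have "d * w * d = 0" using norm_pos_antisym eq by metis
    moreover have "d * d * d = d * w * d - d * q * d"
      by (subst (2) d_def) (simp add: left_diff_distrib right_diff_distrib)
    ultimately have "d * d * d = 0" using eq by simp
    then have "(d * d) * (d * d) = 0" by (metis mult.assoc mult_zero_left)
    then have "d * d = 0" using self_adjoint_square_eq_0[of "d * d"] sd by (simp add: star_mult)
    then show "w = q" using self_adjoint_square_eq_0[OF sd] by (simp add: d_def)
  qed
  show ?thesis using uniq[of y] uniq[of z] assms by simp
qed

lemma cstar_sqrt_eqI: "norm_pos y \<Longrightarrow> y * y = x \<Longrightarrow> cstar_sqrt x = y"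
  unfolding cstar_sqrt_def cstar_pos_iff_norm_pos using norm_pos_sqrt_unique by blast

lemma cstar_sqrt:
  assumes "norm_pos x"
  shows "norm_pos (cstar_sqrt x)" "cstar_sqrt x * cstar_sqrt x = x"
  using assms norm_pos_sqrt cstar_sqrt_eqI by metis+

lemma cstar_abs_norm_pos: "norm_pos x \<Longrightarrow> cstar_abs x = x"
  by (simp add: cstar_abs_def norm_pos_self_adjoint cstar_sqrt_eqI)

lemma norm_pos_norm_minus: "star x = x \<Longrightarrow> norm x \<le> t \<Longrightarrow> norm_pos (t *\<^sub>R 1 - x)"
  by (auto simp: norm_pos_def star_diff star_scaleR intro!: exI[of _ t])

text \<open>Commuting roots \<open>h\<close> of \<open>x\<close> and \<open>k\<close> of
  \<open>r - x\<close> form \<open>u = h + \<i> *\<^sub>C k\<close> with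
  \<open>star u * u = r\<close>. The real part \<open>h\<close> has norm at most
  \<open>norm u\<close>.\<close>

lemma norm_le_if_norm_pos:
  fixes x :: "'a::cstar_algebra"
  assumes "norm_pos x" "norm_pos (r *\<^sub>R 1 - x)"
  shows "norm x \<le> \<bar>r\<bar>"
proof -
  obtain h where h: "norm_pos h" "h * h = x" and h_comm: "\<And>c. c * x = x * c \<Longrightarrow> c * h = h * c"
    using norm_pos_sqrt assms(1) by blast
  obtain k where k: "norm_pos k" "k * k = r *\<^sub>R 1 - x"
    and k_comm: "\<And>c. c * (r *\<^sub>R 1 - x) = (r *\<^sub>R 1 - x) * c \<Longrightarrow> c * k = k * c"
    using norm_pos_sqrt assms(2) by blast
  have "h * x = x * h" using h(2) by (metis mult.assoc)
  then have hk: "h * k = k * h" using k_comm by (simp add: algebra_simps)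
  have sa: "star h = h" "star k = k" using h k norm_pos_self_adjoint by blast+
  define u where "u = h + \<i> *\<^sub>C k"
  have "(norm u)\<^sup>2 = \<bar>r\<bar>"
    using star_mult_self_cartesian[OF sa hk] cstar_identity[of u] by (simp add: u_def h k)
  moreover have "norm h \<le> norm u"
  proof -
    have "2 *\<^sub>R h = u + star u"
      by (simp add: u_def star_add star_scaleC sa scaleR_2)
    then have "norm (2 *\<^sub>R h) \<le> norm u + norm u"
      by (metis norm_triangle_ineq norm_star)
    then show ?thesis by simp
  qed
  ultimately show ?thesis
    using norm_square_self_adjoint[OF sa(1)] h(2) by (metis norm_ge_zero power_mono)
qed

lemma norm_pos_norm_mono:
  fixes x :: "'a::cstar_algebra"
  assumes "norm_pos x" "norm_pos (y - x)"
  shows "norm x \<le> norm y"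
proof -
  have "norm_pos y" using norm_pos_add[OF assms] by simp
  then have "norm_pos (norm y *\<^sub>R 1 - y)"
    by (simp add: norm_pos_norm_minus norm_pos_self_adjoint)
  from norm_pos_add[OF this assms(2)] have "norm_pos (norm y *\<^sub>R 1 - x)" by simp
  from norm_le_if_norm_pos[OF assms(1) this] show ?thesis by simp
qed

text \<open>Abstract form serving both finite sums and operators: \<open>A\<close>,
  \<open>s\<close>, \<open>B\<close> stand for the inner products of f with f, f with g, and g with
  g. Taking \<open>c = s / t\<close> with \<open>t > norm B\<close>, and using that \<open>B\<close>
  is below \<open>t\<close>, gives that \<open>s * star s / t\<close> is below \<open>A\<close>.
  Then \<open>t\<close> decreases to \<open>norm B\<close>, which may be 0.\<close>

lemma Cauchy_Schwarz_norm_pos: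
  fixes s :: "'a::cstar_algebra"
  assumes B: "star B = B"
    and pos: "\<And>c. norm_pos (A - c * star s - s * star c + c * B * star c)"
  shows "(norm s)\<^sup>2 \<le> norm A * norm B"
proof -
  have bound: "(norm s)\<^sup>2 \<le> norm A * t" if t: "t > norm B" for t
  proof -
    have t0: "t > 0" using t by (meson norm_ge_zero order_le_less_trans)
    have "norm_pos (t *\<^sub>R 1 - B)" using B t by (simp add: norm_pos_norm_minus)
    then have "norm_pos ((1/t\<^sup>2) *\<^sub>R (s * (t *\<^sub>R 1 - B) * star s))"
      by (intro norm_pos_scaleR norm_pos_congruence) auto
    from norm_pos_add[OF pos[of "(1/t) *\<^sub>R s"] this]
    have "norm_pos (A - (1/t) *\<^sub>R (s * star s))"
      using t0 by (simp add: star_scaleR algebra_simps power2_eq_square)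
    moreover have "norm_pos ((1/t) *\<^sub>R (s * star s))"
      using t0 by (intro norm_pos_scaleR norm_pos_mult_star) auto
    ultimately have "norm ((1/t) *\<^sub>R (s * star s)) \<le> norm A" by (rule norm_pos_norm_mono[rotated])
    then have "(norm s)\<^sup>2 / t \<le> norm A"
      using t0 by (simp add: cstar_identity')
    then show ?thesis using t0 by (simp add: pos_divide_le_eq)
  qed
  show ?thesis
  proof (rule tendsto_le[of "at_right (norm B)"])
    show "((\<lambda>t. norm A * t) \<longlongrightarrow> norm A * norm B) (at_right (norm B))"
      by (intro tendsto_intros)
    show "eventually (\<lambda>t. (norm s)\<^sup>2 \<le> norm A * t) (at_right (norm B))"
      using bound by (auto simp: eventually_at_filter)
  qed auto
qed

section \<open>Unconditional sums and positivity\<close>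

text \<open>With its converse \<open>summable_onI_tail\<close> this is the Cauchy criterion; it
  carries convergence from one series to another through estimates on finite sets that avoid
  \<open>F0\<close>.\<close>

lemma summable_on_tail:
  fixes f :: "'i \<Rightarrow> 'b::real_normed_vector"
  assumes "f summable_on A" "e > 0"
  obtains F0 where "finite F0" "F0 \<subseteq> A"
    "\<And>F. finite F \<Longrightarrow> F \<subseteq> A \<Longrightarrow> F \<inter> F0 = {} \<Longrightarrow> norm (sum f F) < e"
proof -
  obtain s where "(sum f \<longlongrightarrow> s) (finite_subsets_at_top A)"
    using assms(1) by (auto simp: summable_on_def has_sum_def)
  then have "eventually (\<lambda>F. dist (sum f F) s < e / 2) (finite_subsets_at_top A)"
    using assms(2) by (intro tendstoD) auto
  then obtain F0 where F0: "finite F0" "F0 \<subseteq> A"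
    and near: "\<forall>F. finite F \<and> F0 \<subseteq> F \<and> F \<subseteq> A \<longrightarrow> dist (sum f F) s < e / 2"
    unfolding eventually_finite_subsets_at_top by (elim exE conjE)
  have "norm (sum f F) < e" if F: "finite F" "F \<subseteq> A" "F \<inter> F0 = {}" for F
  proof -
    have "sum f F = sum f (F \<union> F0) - sum f F0"
      using F F0 by (simp add: sum.union_disjoint)
    then have "norm (sum f F) = dist (sum f (F \<union> F0)) (sum f F0)" by (simp add: dist_norm)
    also have "\<dots> < e"
      by (rule dist_triangle_half_l; rule near[rule_format]) (use F F0 in auto)
    finally show ?thesis .
  qed
  with F0 show ?thesis using that by blast
qed

lemma summable_onI_tail:
  fixes f :: "'i \<Rightarrow> 'b::banach"
  assumes "\<And>e. e > 0 \<Longrightarrow> \<exists>F0. finite F0 \<and> F0 \<subseteq> A \<and>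
    (\<forall>F. finite F \<longrightarrow> F \<subseteq> A \<longrightarrow> F \<inter> F0 = {} \<longrightarrow> norm (sum f F) < e)"
  shows "f summable_on A"
proof -
  have "cauchy_filter (filtermap (sum f) (finite_subsets_at_top A))"
    unfolding cauchy_filter_metric_filtermap
  proof (intro allI impI)
    fix e :: real assume "0 < e"
    then obtain F0 where F0: "finite F0" "F0 \<subseteq> A"
      and small: "\<And>F. finite F \<Longrightarrow> F \<subseteq> A \<Longrightarrow> F \<inter> F0 = {} \<Longrightarrow> norm (sum f F) < e / 2"
      using assms[of "e / 2"] by auto
    let ?P = "\<lambda>F. finite F \<and> F0 \<subseteq> F \<and> F \<subseteq> A"
    have "dist (sum f F) (sum f F0) < e / 2" if "?P F" for F
      using small[of "F - F0"] that F0 by (auto simp: dist_norm sum_diff Diff_subset[THEN subset_trans])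
    then have "dist (sum f F) (sum f F') < e" if "?P F" "?P F'" for F F'
      using that by (blast intro: dist_triangle_half_l)
    moreover have "eventually ?P (finite_subsets_at_top A)"
      using F0 by (auto simp: eventually_finite_subsets_at_top)
    ultimately show "\<exists>P. eventually P (finite_subsets_at_top A) \<and>
        (\<forall>F F'. P F \<and> P F' \<longrightarrow> dist (sum f F) (sum f F') < e)"
      by (intro exI[of _ ?P]) simp
  qed
  moreover have "complete (UNIV::'b set)"
    by (meson Cauchy_convergent UNIV_I complete_def convergent_def)
  ultimately obtain s where "(sum f \<longlongrightarrow> s) (finite_subsets_at_top A)"
    using complete_uniform[where S = UNIV] by (force simp: filterlim_def)
  then show ?thesis by (auto simp: summable_on_def has_sum_def)
qed

lemma has_sum_diff:
  fixes f g :: "'i \<Rightarrow> 'b::real_normed_vector"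
  assumes "(f has_sum s) A" "(g has_sum t) A"
  shows "((\<lambda>i. f i - g i) has_sum (s - t)) A"
  using has_sum_add[OF assms(1), of "\<lambda>i. - g i" "- t"] assms(2) by (simp add: has_sum_uminus)

lemma cstar_le_iff_norm_pos: "x \<sqsubseteq>\<^sub>A y \<longleftrightarrow> norm_pos (y - x)"
  by (simp add: cstar_le_def cstar_pos_iff_norm_pos)

lemma norm_pos_0 [simp]: "norm_pos 0"
  using norm_pos_of_real[of 0] by simp

lemma norm_pos_sum: "(\<And>i. i \<in> F \<Longrightarrow> norm_pos (f i)) \<Longrightarrow> norm_pos (sum f F)"
  by (induction F rule: infinite_finite_induct) (auto intro: norm_pos_add)

lemma norm_pos_has_sum:
  assumes "(f has_sum s) A" "\<And>i. i \<in> A \<Longrightarrow> norm_pos (f i)"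
  shows "norm_pos s"
proof (rule norm_pos_tendsto)
  show "(sum f \<longlongrightarrow> s) (finite_subsets_at_top A)" using assms(1) by (simp add: has_sum_def)
  show "eventually (\<lambda>F. norm_pos (sum f F)) (finite_subsets_at_top A)"
    using assms(2) by (auto intro!: norm_pos_sum)
qed simp

lemma norm_pos_has_sum_minus_sum:
  assumes "(f has_sum s) A" "\<And>i. i \<in> A \<Longrightarrow> norm_pos (f i)" "finite F" "F \<subseteq> A"
  shows "norm_pos (s - sum f F)"
proof (rule norm_pos_tendsto)
  show "((\<lambda>F'. sum f F' - sum f F) \<longlongrightarrow> s - sum f F) (finite_subsets_at_top A)"
    using assms(1) by (intro tendsto_intros) (simp add: has_sum_def)
  have "norm_pos (sum f F' - sum f F)" if "finite F'" "F \<subseteq> F'" "F' \<subseteq> A" for F'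
  proof -
    have "sum f F' - sum f F = sum f (F' - F)" using that by (simp add: sum_diff)
    then show ?thesis using that assms(2) by (auto intro!: norm_pos_sum)
  qed
  then show "eventually (\<lambda>F'. norm_pos (sum f F' - sum f F)) (finite_subsets_at_top A)"
    using assms(3,4) by (auto simp: eventually_finite_subsets_at_top)
qed simp

text \<open>The required quadratic expression in \<open>c\<close> is a sum of positive elements
  \<open>x * star x\<close> with \<open>x = a i - c * star (b i)\<close>.\<close>

lemma Cauchy_Schwarz_sum:
  fixes a b :: "'i \<Rightarrow> 'a::cstar_algebra"
  shows "(norm (\<Sum>i\<in>F. a i * b i))\<^sup>2 \<le>
    norm (\<Sum>i\<in>F. a i * star (a i)) * norm (\<Sum>i\<in>F. star (b i) * b i)"
proof (rule Cauchy_Schwarz_norm_pos)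
  show "star (\<Sum>i\<in>F. star (b i) * b i) = (\<Sum>i\<in>F. star (b i) * b i)"
    by (simp add: star_sum star_mult star_star)
  fix c
  have "norm_pos (\<Sum>i\<in>F. (a i - c * star (b i)) * star (a i - c * star (b i)))"
    by (intro norm_pos_sum norm_pos_mult_star)
  also have "(\<Sum>i\<in>F. (a i - c * star (b i)) * star (a i - c * star (b i))) =
    (\<Sum>i\<in>F. a i * star (a i)) - c * star (\<Sum>i\<in>F. a i * b i) - (\<Sum>i\<in>F. a i * b i) * star c
      + c * (\<Sum>i\<in>F. star (b i) * b i) * star c"
    by (simp add: star_diff star_mult star_star star_sum sum_distrib_left sum_distrib_right
        algebra_simps sum.distrib sum_subtractf)
  finally show "norm_pos \<dots>" .
qed

section \<open>Frames in Hilbert modules\<close>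

context hilbert_module
begin

lemma ip_add_right: "ip f (g + h) = ip f g + ip f h"
  by (simp add: ip_star[of f] ip_add_left star_add)

lemma ip_act_right: "ip f (act a g) = ip f g * star a"
  by (simp add: ip_star[of f] ip_act_left star_mult)

lemma ip_scaleR_left: "ip (r *\<^sub>R f) g = r *\<^sub>R ip f g"
  by (simp add: scaleR_act ip_act_left)

lemma ip_scaleR_right: "ip f (r *\<^sub>R g) = r *\<^sub>R ip f g"
  by (simp add: scaleR_act ip_act_right star_scaleR)

lemma ip_minus_left: "ip (- f) g = - ip f g"
  using ip_scaleR_left[of "- 1" f g] by simp

lemma ip_minus_right: "ip f (- g) = - ip f g"
  using ip_scaleR_right[of f "- 1" g] by simp

lemma ip_diff_left: "ip (f - g) h = ip f h - ip g h"
  using ip_add_left[of f "- g" h] by (simp add: ip_minus_left)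

lemma ip_diff_right: "ip f (g - h) = ip f g - ip f h"
  using ip_add_right[of f g "- h"] by (simp add: ip_minus_right)

lemma act_minus_left: "act (- a) f = - act a f"
proof -
  have "act (- a) f = act ((- 1) *\<^sub>R 1) (act a f)" by (simp add: act_act)
  also have "\<dots> = (- 1) *\<^sub>R act a f" by (simp only: scaleR_act)
  finally show ?thesis by simp
qed

lemma norm_pos_ip: "norm_pos (ip f f)"
  using ip_pos[of f] by (simp add: cstar_le_iff_norm_pos)

lemma power2_norm_ip: "(norm f)\<^sup>2 = norm (ip f f)"
  by (simp add: norm_ip)

lemma ip_eqI:
  assumes "\<And>h. ip f h = ip g h"
  shows "f = g"
  using ip_definite[of "f - g"] assms by (simp add: ip_diff_left)

section \<open>Cauchy-Schwarz for operators and invertibility\<close>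

lemma Cauchy_Schwarz_operator:
  assumes sa: "\<And>f g. ip (V f) g = ip f (V g)" and pos: "\<And>f. norm_pos (ip (V f) f)"
  shows "(norm (ip (V f) g))\<^sup>2 \<le> norm (ip (V f) f) * norm (ip (V g) g)"
proof (rule Cauchy_Schwarz_norm_pos)
  show "star (ip (V g) g) = ip (V g) g" using pos by (rule norm_pos_self_adjoint)
  fix c
  have s: "star (ip (V f) g) = ip (V g) f" by (metis ip_star sa)
  \<comment> \<open>Linearity of the map \<open>V\<close> is not assumed; inside the inner product
    it follows by moving \<open>V\<close> to the other side.\<close>
  have V: "ip (V (h - act c g)) k = ip (V h) k - c * ip (V g) k" for h k
    by (simp add: sa ip_diff_left ip_act_left)
  have "ip (V (f - act c g)) (f - act c g) =
    ip (V f) f - c * ip (V g) f - ip (V f) g * star c + c * ip (V g) g * star c"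
    unfolding V by (simp add: ip_diff_right ip_act_right algebra_simps)
  with pos[of "f - act c g"]
  show "norm_pos (ip (V f) f - c * star (ip (V f) g) - ip (V f) g * star c
      + c * ip (V g) g * star c)"
    by (simp add: s)
qed

lemma norm_ip_le: "norm (ip f g) \<le> norm f * norm g"
proof -
  have "(norm (ip f g))\<^sup>2 \<le> (norm f * norm g)\<^sup>2"
    using Cauchy_Schwarz_operator[of "\<lambda>f. f" f g] norm_pos_ip
    by (simp add: power_mult_distrib power2_norm_ip)
  then show ?thesis by (rule power2_le_imp_le) simp
qed

lemma bounded_linear_ip_left: "bounded_linear (\<lambda>f. ip f g)"
  by (rule bounded_linear_intro[where K = "norm g"])
    (auto simp: ip_add_left ip_scaleR_left norm_ip_le)

lemma bounded_linear_ip_right: "bounded_linear (\<lambda>g. ip f g)"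
  by (rule bounded_linear_intro[where K = "norm f"])
    (simp add: ip_add_right ip_scaleR_right, simp add: ip_scaleR_right,
      subst mult.commute, rule norm_ip_le)

lemma ip_sum_left: "ip (sum f F) g = (\<Sum>i\<in>F. ip (f i) g)"
  by (rule linear_sum[OF bounded_linear.linear[OF bounded_linear_ip_left]])

text \<open>Cauchy-Schwarz with \<open>g = V f\<close> bounds the fourth power of
  \<open>norm (V f)\<close> by \<open>k * (norm f)^2\<close> times
  \<open>k * (norm (V f))^2\<close>.\<close>

lemma norm_operator_le:
  assumes sa: "\<And>f g. ip (V f) g = ip f (V g)" and pos: "\<And>f. norm_pos (ip (V f) f)"
    and bound: "\<And>f. norm (ip (V f) f) \<le> k * (norm f)\<^sup>2" and "0 \<le> k"
  shows "norm (V f) \<le> k * norm f"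
proof (cases "V f = 0")
  case False
  have "((norm (V f))\<^sup>2)\<^sup>2 = (norm (ip (V f) (V f)))\<^sup>2"
    by (simp add: power2_norm_ip)
  also have "\<dots> \<le> norm (ip (V f) f) * norm (ip (V (V f)) (V f))"
    by (rule Cauchy_Schwarz_operator[OF sa pos])
  also have "\<dots> \<le> (k * (norm f)\<^sup>2) * (k * (norm (V f))\<^sup>2)"
    by (intro mult_mono bound) (use \<open>0 \<le> k\<close> in auto)
  also have "\<dots> = (k * norm f)\<^sup>2 * (norm (V f))\<^sup>2"
    by (simp add: power2_eq_square mult_ac)
  finally have "(norm (V f))\<^sup>2 \<le> (k * norm f)\<^sup>2"
    using False by (simp add: power2_eq_square)
  then show ?thesis by (rule power2_le_imp_le) (use \<open>0 \<le> k\<close> in auto)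
qed (use \<open>0 \<le> k\<close> in auto)

lemma op_invertible_of_bounds:
  assumes sa: "\<And>f g. ip (T f) g = ip f (T g)" and "0 < c" "c < d"
    and lower: "\<And>f. norm_pos (ip (T f) f - c *\<^sub>R ip f f)"
    and upper: "\<And>f. norm_pos (d *\<^sub>R ip f f - ip (T f) f)"
  shows "op_invertible ip T"
proof -
  define V where "V f = f - (1/d) *\<^sub>R T f" for f
  define k where "k = 1 - c / d"
  have k: "0 \<le> k" "k < 1" using assms(2,3) by (auto simp: k_def)
  have V_sa: "ip (V f) g = ip f (V g)" for f g
    by (simp add: V_def ip_diff_left ip_diff_right ip_scaleR_left ip_scaleR_right sa)
  have V_pos: "norm_pos (ip (V f) f)" for f
    using norm_pos_scaleR[OF upper[of f], of "1/d"] assms(2,3)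
    by (simp add: V_def ip_diff_left ip_scaleR_left scaleR_diff_right)
  have "norm (ip (V f) f) \<le> norm (k *\<^sub>R ip f f)" for f
  proof (rule norm_pos_norm_mono[OF V_pos])
    have "k *\<^sub>R ip f f - ip (V f) f = (1/d) *\<^sub>R (ip (T f) f - c *\<^sub>R ip f f)"
      by (simp add: V_def k_def ip_diff_left ip_scaleR_left algebra_simps)
    then show "norm_pos (k *\<^sub>R ip f f - ip (V f) f)"
      using norm_pos_scaleR[OF lower[of f], of "1/d"] assms(2,3) by simp
  qed
  then have V_le: "norm (V f) \<le> k * norm f" for f
    using norm_operator_le[of V k, OF V_sa V_pos] k by (simp add: power2_norm_ip)
  have V_diff: "V f - V g = V (f - g)" for f g
    by (rule ip_eqI) (simp add: V_sa ip_diff_left)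
  \<comment> \<open>The fixed points of this contraction are exactly the solutions of
    \<open>T x = g\<close>.\<close>
  have "\<exists>!x. V x + (1/d) *\<^sub>R g = x" for g
    using k V_le by (intro banach_fix_type[of k]) (auto simp: dist_norm V_diff)
  moreover have "V x + (1/d) *\<^sub>R g = x \<longleftrightarrow> T x = g" for x g
    using assms(2,3) by (auto simp: V_def algebra_simps)
  ultimately have ex1: "\<exists>!x. T x = g" for g by simp
  define R where "R g = (THE x. T x = g)" for g
  have TR: "T (R g) = g" for g using theI'[OF ex1[of g]] by (simp add: R_def)
  then have RT: "R (T f) = f" for f using ex1[of "T f"] by blast
  \<comment> \<open>Write \<open>g\<close> as \<open>T (R g)\<close> and move \<open>T\<close>
    across: the inverse is its own adjoint.\<close>
  have "ip (R f) g = ip f (R g)" for f g by (metis sa TR)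
  with TR RT sa show ?thesis by (auto simp: op_invertible_def adjointable_def)
qed

section \<open>Frame operators\<close>

lemma frame_summand_pos: "norm_pos (ip f g * ip g f)"
  using norm_pos_mult_star[of "ip f g"] by (simp flip: ip_star)

lemma frame_operator_summable:
  assumes "is_frame ip J \<phi>"
  shows "(\<lambda>j. act (ip f (\<phi> j)) (\<phi> j)) summable_on J"
proof (rule summable_onI_tail)
  fix e :: real assume "e > 0"
  obtain \<beta> where "\<beta> > 0"
    and summ: "\<And>f. (\<lambda>j. ip f (\<phi> j) * ip (\<phi> j) f) summable_on J"
    and upper: "\<And>f. norm_pos (\<beta> *\<^sub>R ip f f - (\<Sum>\<^sub>\<infinity>j\<in>J. ip f (\<phi> j) * ip (\<phi> j) f))"
    using assms by (auto simp: is_frame_def cstar_le_iff_norm_pos)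
  \<comment> \<open>A finite partial sum lies below the full sum of positive terms, hence below
    \<open>\<beta> *\<^sub>R ip f f\<close>.\<close>
  have bessel: "norm (\<Sum>j\<in>F. ip f (\<phi> j) * ip (\<phi> j) f) \<le> \<beta> * (norm f)\<^sup>2"
    if "finite F" "F \<subseteq> J" for F f
  proof -
    have "norm_pos ((\<Sum>\<^sub>\<infinity>j\<in>J. ip f (\<phi> j) * ip (\<phi> j) f) - (\<Sum>j\<in>F. ip f (\<phi> j) * ip (\<phi> j) f))"
      by (rule norm_pos_has_sum_minus_sum[OF has_sum_infsum[OF summ] frame_summand_pos that])
    from norm_pos_add[OF upper[of f] this]
    have "norm_pos (\<beta> *\<^sub>R ip f f - (\<Sum>j\<in>F. ip f (\<phi> j) * ip (\<phi> j) f))" by simp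
    moreover have "norm_pos (\<Sum>j\<in>F. ip f (\<phi> j) * ip (\<phi> j) f)"
      by (intro norm_pos_sum frame_summand_pos)
    ultimately show ?thesis
      using norm_pos_norm_mono \<open>\<beta> > 0\<close> by (fastforce simp: power2_norm_ip)
  qed
  \<comment> \<open>For the partial sum \<open>h\<close>, Cauchy-Schwarz splits
    \<open>ip h h\<close> into a piece of the frame sum of \<open>f\<close> and one of
    \<open>h\<close>. The Bessel bound absorbs the latter into \<open>(norm h)^2\<close>, which then
    cancels.\<close>
  have tail: "(norm (\<Sum>j\<in>F. act (ip f (\<phi> j)) (\<phi> j)))\<^sup>2 \<le>
      \<beta> * norm (\<Sum>j\<in>F. ip f (\<phi> j) * ip (\<phi> j) f)" if "finite F" "F \<subseteq> J" for F
  proof (cases "(\<Sum>j\<in>F. act (ip f (\<phi> j)) (\<phi> j)) = 0")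
    case False
    define h where "h = (\<Sum>j\<in>F. act (ip f (\<phi> j)) (\<phi> j))"
    let ?X = "norm (\<Sum>j\<in>F. ip f (\<phi> j) * ip (\<phi> j) f)"
    have "ip h h = (\<Sum>j\<in>F. ip f (\<phi> j) * ip (\<phi> j) h)"
      by (subst (1) h_def) (simp add: ip_sum_left ip_act_left)
    then have "((norm h)\<^sup>2)\<^sup>2 = (norm (\<Sum>j\<in>F. ip f (\<phi> j) * ip (\<phi> j) h))\<^sup>2"
      by (simp add: power2_norm_ip)
    also have "\<dots> \<le> norm (\<Sum>j\<in>F. ip f (\<phi> j) * star (ip f (\<phi> j))) *
        norm (\<Sum>j\<in>F. star (ip (\<phi> j) h) * ip (\<phi> j) h)"
      by (rule Cauchy_Schwarz_sum)
    also have "\<dots> = ?X * norm (\<Sum>j\<in>F. ip h (\<phi> j) * ip (\<phi> j) h)"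
      by (simp flip: ip_star)
    also have "\<dots> \<le> ?X * (\<beta> * (norm h)\<^sup>2)"
      by (intro mult_left_mono bessel that) simp
    finally have "(norm h)\<^sup>2 * (norm h)\<^sup>2 \<le> (\<beta> * ?X) * (norm h)\<^sup>2"
      by (simp add: power2_eq_square mult_ac)
    moreover have "0 < (norm h)\<^sup>2" using False by (simp flip: h_def)
    ultimately show ?thesis unfolding h_def[symmetric] by (rule mult_right_le_imp_le)
  qed (use \<open>\<beta> > 0\<close> in auto)
  have "e\<^sup>2 / \<beta> > 0" using \<open>e > 0\<close> \<open>\<beta> > 0\<close> by simp
  then obtain F0 where F0: "finite F0" "F0 \<subseteq> J" and small: "\<And>F. finite F \<Longrightarrow> F \<subseteq> J \<Longrightarrow> F \<inter> F0 = {} \<Longrightarrow>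
      norm (\<Sum>j\<in>F. ip f (\<phi> j) * ip (\<phi> j) f) < e\<^sup>2 / \<beta>"
    using summable_on_tail[OF summ[of f]] by metis
  have "norm (\<Sum>j\<in>F. act (ip f (\<phi> j)) (\<phi> j)) < e" if F: "finite F" "F \<subseteq> J" "F \<inter> F0 = {}" for F
  proof -
    have "\<beta> * norm (\<Sum>j\<in>F. ip f (\<phi> j) * ip (\<phi> j) f) < e\<^sup>2"
      using small[OF F] \<open>\<beta> > 0\<close> by (simp add: field_simps)
    with tail[OF F(1,2)] have "(norm (\<Sum>j\<in>F. act (ip f (\<phi> j)) (\<phi> j)))\<^sup>2 < e\<^sup>2" by simp
    then show ?thesis using \<open>e > 0\<close> by (simp add: power2_less_imp_less)
  qed
  with F0 show "\<exists>F0. finite F0 \<and> F0 \<subseteq> J \<and> (\<forall>F. finite F \<longrightarrow> F \<subseteq> J \<longrightarrow> F \<inter> F0 = {} \<longrightarrow>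
      norm (\<Sum>j\<in>F. act (ip f (\<phi> j)) (\<phi> j)) < e)"
    by blast
qed

lemma frame_operator_properties:
  assumes frame: "is_frame ip J \<phi>" and S: "is_frame_operator act ip J \<phi> S"
  shows "op_positive ip S" "op_self_adjoint ip S" "op_invertible ip S"
proof -
  obtain \<alpha> \<beta> where "\<alpha> > 0" "\<beta> > 0"
    and lower: "\<And>f. norm_pos ((\<Sum>\<^sub>\<infinity>j\<in>J. ip f (\<phi> j) * ip (\<phi> j) f) - \<alpha> *\<^sub>R ip f f)"
    and upper: "\<And>f. norm_pos (\<beta> *\<^sub>R ip f f - (\<Sum>\<^sub>\<infinity>j\<in>J. ip f (\<phi> j) * ip (\<phi> j) f))"
    using frame by (auto simp: is_frame_def cstar_le_iff_norm_pos)
  have S_sum: "((\<lambda>j. act (ip f (\<phi> j)) (\<phi> j)) has_sum S f) J" for f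
    using S by (simp add: is_frame_operator_def)
  have left: "((\<lambda>j. ip f (\<phi> j) * ip (\<phi> j) g) has_sum ip (S f) g) J" for f g
    using has_sum_bounded_linear[OF bounded_linear_ip_left S_sum[of f], of g]
    by (simp add: ip_act_left)
  have right: "((\<lambda>j. ip f (\<phi> j) * ip (\<phi> j) g) has_sum ip f (S g)) J" for f g
    using has_sum_bounded_linear[OF bounded_linear_ip_right S_sum[of g], of f]
    by (simp add: ip_act_right flip: ip_star)
  have sa: "ip (S f) g = ip f (S g)" for f g
    using has_sum_unique[OF left right] .
  \<comment> \<open>\<open>sa\<close> holds because \<open>left\<close> and \<open>right\<close>
    assign two values to the same series.\<close>
  then show "op_self_adjoint ip S" by (simp add: op_self_adjoint_def)
  have "norm_pos (ip (S f) f)" for f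
    using left frame_summand_pos by (rule norm_pos_has_sum)
  with sa show "op_positive ip S"
    by (auto simp: op_positive_def adjointable_def cstar_le_iff_norm_pos)
  have infsum: "(\<Sum>\<^sub>\<infinity>j\<in>J. ip f (\<phi> j) * ip (\<phi> j) f) = ip (S f) f" for f
    using left by (rule infsumI)
  show "op_invertible ip S"
  proof (rule op_invertible_of_bounds[of S, OF sa])
    \<comment> \<open>The upper constant is \<open>\<alpha> + \<beta>\<close> because a strictly
      larger one is required, and \<open>\<alpha>\<close> may equal \<open>\<beta>\<close>.\<close>
    show "0 < \<alpha>" "\<alpha> < \<alpha> + \<beta>" using \<open>\<alpha> > 0\<close> \<open>\<beta> > 0\<close> by auto
    show "norm_pos (ip (S f) f - \<alpha> *\<^sub>R ip f f)" for f using lower[of f] by (simp add: infsum)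
    show "norm_pos ((\<alpha> + \<beta>) *\<^sub>R ip f f - ip (S f) f)" for f
      using norm_pos_add[OF norm_pos_scaleR[OF norm_pos_ip[of f], of \<alpha>] upper[of f]] \<open>\<alpha> > 0\<close>
      by (simp add: infsum algebra_simps)
  qed
qed

section \<open>Multipliers as frame operators\<close>

lemma is_frame_act_sqrt:
  assumes frame: "is_frame ip J \<psi>" and "0 < a" "a \<le> b"
    and m: "\<And>j. j \<in> J \<Longrightarrow> norm_pos (m j)"
    and lower_m: "\<And>j. j \<in> J \<Longrightarrow> norm_pos (m j - a *\<^sub>R 1)"
    and upper_m: "\<And>j. j \<in> J \<Longrightarrow> norm_pos (b *\<^sub>R 1 - m j)"
  shows "is_frame ip J (\<lambda>j. act (cstar_sqrt (m j)) (\<psi> j))" (is "is_frame ip J ?\<phi>")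
proof -
  obtain \<alpha> \<beta> where "\<alpha> > 0" "\<beta> > 0"
    and summ: "\<And>f. (\<lambda>j. ip f (\<psi> j) * ip (\<psi> j) f) summable_on J"
    and lower: "\<And>f. norm_pos ((\<Sum>\<^sub>\<infinity>j\<in>J. ip f (\<psi> j) * ip (\<psi> j) f) - \<alpha> *\<^sub>R ip f f)"
    and upper: "\<And>f. norm_pos (\<beta> *\<^sub>R ip f f - (\<Sum>\<^sub>\<infinity>j\<in>J. ip f (\<psi> j) * ip (\<psi> j) f))"
    using frame by (auto simp: is_frame_def cstar_le_iff_norm_pos)
  have "b > 0" using assms(2,3) by simp
  have bounds: "(\<lambda>j. ip f (?\<phi> j) * ip (?\<phi> j) f) summable_on J \<and>
      norm_pos ((\<Sum>\<^sub>\<infinity>j\<in>J. ip f (?\<phi> j) * ip (?\<phi> j) f) - (a * \<alpha>) *\<^sub>R ip f f) \<and>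
      norm_pos ((b * \<beta>) *\<^sub>R ip f f - (\<Sum>\<^sub>\<infinity>j\<in>J. ip f (?\<phi> j) * ip (?\<phi> j) f))" for f
  proof -
    define X where "X j = ip f (\<psi> j) * ip (\<psi> j) f" for j
    define M where "M j = ip f (?\<phi> j) * ip (?\<phi> j) f" for j
    have M: "M j = ip f (\<psi> j) * m j * star (ip f (\<psi> j))" if "j \<in> J" for j
      using cstar_sqrt[OF m[OF that]]
      by (simp add: M_def ip_act_right ip_act_left norm_pos_self_adjoint flip: ip_star)
        (metis mult.assoc)
    have X: "X j = ip f (\<psi> j) * star (ip f (\<psi> j))" for j
      by (simp add: X_def flip: ip_star)
    have MX: "norm_pos (M j - a *\<^sub>R X j)" "norm_pos (b *\<^sub>R X j - M j)" if "j \<in> J" for j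
      using norm_pos_congruence[OF lower_m[OF that], of "ip f (\<psi> j)"]
        norm_pos_congruence[OF upper_m[OF that], of "ip f (\<psi> j)"] that
      by (simp_all add: M X algebra_simps)
    \<comment> \<open>Domination of finite sums transfers the Cauchy criterion from \<open>X\<close>
      to \<open>M\<close>.\<close>
    have sum_le: "norm (sum M F) \<le> b * norm (sum X F)" if "F \<subseteq> J" for F
    proof -
      have "norm_pos (\<Sum>j\<in>F. b *\<^sub>R X j - M j)" using that MX by (auto intro!: norm_pos_sum)
      then have "norm_pos (b *\<^sub>R sum X F - sum M F)"
        by (simp add: sum_subtractf scaleR_sum_right)
      moreover have "norm_pos (sum M F)"
        unfolding M_def by (intro norm_pos_sum frame_summand_pos)
      ultimately have "norm (sum M F) \<le> norm (b *\<^sub>R sum X F)" by (metis norm_pos_norm_mono)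
      then show ?thesis using \<open>b > 0\<close> by simp
    qed
    have sX: "X summable_on J" using summ by (simp add: X_def[abs_def])
    have sM: "M summable_on J"
    proof (rule summable_onI_tail)
      fix e :: real assume "e > 0"
      then have "e / b > 0" using \<open>b > 0\<close> by simp
      then obtain F0 where F0: "finite F0" "F0 \<subseteq> J" and small:
        "\<And>F. finite F \<Longrightarrow> F \<subseteq> J \<Longrightarrow> F \<inter> F0 = {} \<Longrightarrow> norm (sum X F) < e / b"
        using summable_on_tail[OF sX] by metis
      have "norm (sum M F) < e" if F: "finite F" "F \<subseteq> J" "F \<inter> F0 = {}" for F
      proof -
        have "b * norm (sum X F) < e" using small[OF F] \<open>b > 0\<close> by (simp add: field_simps)
        with sum_le[OF F(2)] show ?thesis by simp
      qed
      with F0 show "\<exists>F0. finite F0 \<and> F0 \<subseteq> J \<and>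
          (\<forall>F. finite F \<longrightarrow> F \<subseteq> J \<longrightarrow> F \<inter> F0 = {} \<longrightarrow> norm (sum M F) < e)" by blast
    qed
    have scale: "((\<lambda>j. r *\<^sub>R X j) has_sum r *\<^sub>R infsum X J) J" for r
      by (rule has_sum_bounded_linear[OF bounded_linear_scaleR_right has_sum_infsum[OF sX]])
    have "norm_pos (infsum M J - a *\<^sub>R infsum X J)" "norm_pos (b *\<^sub>R infsum X J - infsum M J)"
      using has_sum_diff[OF has_sum_infsum[OF sM] scale[of a]]
        has_sum_diff[OF scale[of b] has_sum_infsum[OF sM]] MX by (auto intro: norm_pos_has_sum)
    moreover have "norm_pos (a *\<^sub>R (infsum X J - \<alpha> *\<^sub>R ip f f))"
      "norm_pos (b *\<^sub>R (\<beta> *\<^sub>R ip f f - infsum X J))"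
      using lower[of f] upper[of f] \<open>0 < a\<close> \<open>b > 0\<close>
      by (auto simp: X_def[abs_def] intro!: norm_pos_scaleR)
    \<comment> \<open>Adding the comparison of \<open>M\<close> with \<open>X\<close> to the scaled
      old frame inequalities yields the new bounds \<open>a * \<alpha>\<close> and
      \<open>b * \<beta>\<close>.\<close>
    ultimately have "norm_pos ((infsum M J - a *\<^sub>R infsum X J) + a *\<^sub>R (infsum X J - \<alpha> *\<^sub>R ip f f))"
      "norm_pos (b *\<^sub>R (\<beta> *\<^sub>R ip f f - infsum X J) + (b *\<^sub>R infsum X J - infsum M J))"
      by (auto intro: norm_pos_add)
    then have "norm_pos (infsum M J - (a * \<alpha>) *\<^sub>R ip f f)" "norm_pos ((b * \<beta>) *\<^sub>R ip f f - infsum M J)"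
      by (simp_all add: scaleR_right_diff_distrib)
    with sM show ?thesis by (simp add: M_def[abs_def])
  qed
  show ?thesis
    unfolding is_frame_def cstar_le_iff_norm_pos
    using bounds \<open>0 < a\<close> \<open>\<alpha> > 0\<close> \<open>b > 0\<close> \<open>\<beta> > 0\<close>
    by (intro exI[of _ "a * \<alpha>"] exI[of _ "b * \<beta>"]) auto
qed

lemma positive_multiplier:
  assumes frame: "is_frame ip J \<psi>" and central: "m ` J \<subseteq> alg_center"
    and semi: "semi_normalized J m" and pos: "positive_seq J m"
  shows "multiplier_converges act ip J m \<psi>"
    and "is_frame ip J (\<lambda>j. act (cstar_sqrt (m j)) (\<psi> j))"
    and "is_frame_operator act ip J (\<lambda>j. act (cstar_sqrt (m j)) (\<psi> j)) (multiplier act ip J m \<psi>)"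
proof -
  let ?\<phi> = "\<lambda>j. act (cstar_sqrt (m j)) (\<psi> j)"
  have m: "norm_pos (m j)" if "j \<in> J" for j
    using pos that by (simp add: positive_seq_def cstar_le_iff_norm_pos)
  \<comment> \<open>A positive \<open>m j\<close> equals its absolute value, so semi-normalization
    bounds \<open>m j\<close> itself.\<close>
  obtain a b where "0 < a" "a \<le> b" and
    "\<And>j. j \<in> J \<Longrightarrow> norm_pos (m j - a *\<^sub>R 1)" "\<And>j. j \<in> J \<Longrightarrow> norm_pos (b *\<^sub>R 1 - m j)"
    using semi unfolding semi_normalized_def cstar_le_iff_norm_pos
    by (metis cstar_abs_norm_pos m)
  then show frame': "is_frame ip J ?\<phi>"
    using is_frame_act_sqrt[OF frame] m by blast
  have eq: "act (ip f (?\<phi> j)) (?\<phi> j) = act (m j * ip f (\<psi> j)) (\<psi> j)" if "j \<in> J" for f j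
  proof -
    \<comment> \<open>The two roots meet to the right of the coefficient; centrality moves their
      product \<open>m j\<close> to the left.\<close>
    have "ip f (\<psi> j) * cstar_sqrt (m j) * cstar_sqrt (m j) = m j * ip f (\<psi> j)"
    proof -
      have "m j \<in> alg_center" using central that by blast
      then have "m j * ip f (\<psi> j) = ip f (\<psi> j) * m j" unfolding alg_center_def by blast
      then show ?thesis using cstar_sqrt(2)[OF m[OF that]] by (simp only: mult.assoc)
    qed
    then show ?thesis
      using cstar_sqrt(1)[OF m[OF that]]
      by (simp add: ip_act_right act_act norm_pos_self_adjoint)
  qed
  have sum: "((\<lambda>j. act (ip f (?\<phi> j)) (?\<phi> j)) has_sum multiplier act ip J m \<psi> f) J" for f
    unfolding multiplier_def
    using has_sum_infsum[OF frame_operator_summable[OF frame', of f]] eq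
    by (simp cong: infsum_cong)
  then show "is_frame_operator act ip J ?\<phi> (multiplier act ip J m \<psi>)"
    by (simp add: is_frame_operator_def)
  show "multiplier_converges act ip J m \<psi>"
    unfolding multiplier_converges_def
    using frame_operator_summable[OF frame'] eq by (simp cong: summable_on_cong)
qed

lemma op_invertible_uminus:
  assumes "op_invertible ip (\<lambda>f. - T f)"
  shows "op_invertible ip T"
proof -
  obtain T' R R' where T': "\<And>f g. ip (- T f) g = ip f (T' g)"
    and R': "\<And>f g. ip (R f) g = ip f (R' g)"
    and R: "\<And>f. R (- T f) = f" "\<And>f. - T (R f) = f"
    using assms unfolding op_invertible_def adjointable_def by metis
  have "ip (T f) g = ip f (- T' g)" for f g
  proof -
    have "ip (T f) g = - ip (- T f) g" by (simp add: ip_minus_left)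
    also have "\<dots> = ip f (- T' g)" by (simp only: T' ip_minus_right)
    finally show ?thesis .
  qed
  then have "adjointable ip T" by (auto simp: adjointable_def)
  moreover have "adjointable ip (\<lambda>f. R (- f))"
    unfolding adjointable_def by (intro exI[of _ "\<lambda>g. - R' g"])
      (simp add: ip_minus_left ip_minus_right R')
  moreover have "T (R (- f)) = f" for f using R(2)[of "- f"] by simp
  ultimately show ?thesis using R(1) by (auto simp: op_invertible_def)
qed

end

lemma semi_normalized_uminus: "semi_normalized J (\<lambda>j. - c j) \<longleftrightarrow> semi_normalized J c"
  by (simp add: semi_normalized_def cstar_abs_def star_uminus)

theorem lemma4p6:
  fixes act :: "'a::cstar_algebra \<Rightarrow> 'h::banach \<Rightarrow> 'h"
    and ip :: "'h \<Rightarrow> 'h \<Rightarrow> 'a"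
    and J :: "'j set"
    and \<psi> :: "'j \<Rightarrow> 'h"
    and m :: "'j \<Rightarrow> 'a"
  assumes "hilbert_module act ip"
    and "finitely_generated act \<or> countably_generated act"
    and "countable J"
    and "is_frame ip J \<psi>"
    and "m ` J \<subseteq> alg_center"
    and "semi_normalized J m"
  shows "(positive_seq J m \<longrightarrow>
            multiplier_converges act ip J m \<psi> \<and>
            is_frame ip J (\<lambda>j. act (cstar_sqrt (m j)) (\<psi> j)) \<and>
            is_frame_operator act ip J (\<lambda>j. act (cstar_sqrt (m j)) (\<psi> j))
              (multiplier act ip J m \<psi>) \<and>
            op_positive ip (multiplier act ip J m \<psi>) \<and>
            op_self_adjoint ip (multiplier act ip J m \<psi>) \<and>
            op_invertible ip (multiplier act ip J m \<psi>)) \<and>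
         (negative_seq J m \<longrightarrow>
            multiplier_converges act ip J m \<psi> \<and>
            op_negative ip (multiplier act ip J m \<psi>) \<and>
            op_self_adjoint ip (multiplier act ip J m \<psi>) \<and>
            op_invertible ip (multiplier act ip J m \<psi>))"
proof (intro conjI impI)
  interpret hilbert_module act ip by fact
  note frame = \<open>is_frame ip J \<psi>\<close> and central = \<open>m ` J \<subseteq> alg_center\<close>
    and semi = \<open>semi_normalized J m\<close>
  {
    assume "positive_seq J m"
    note mult = positive_multiplier[OF frame central semi this]
    show "multiplier_converges act ip J m \<psi>"
      "is_frame ip J (\<lambda>j. act (cstar_sqrt (m j)) (\<psi> j))"
      "is_frame_operator act ip J (\<lambda>j. act (cstar_sqrt (m j)) (\<psi> j)) (multiplier act ip J m \<psi>)"
      by (fact mult)+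
    show "op_positive ip (multiplier act ip J m \<psi>)" "op_self_adjoint ip (multiplier act ip J m \<psi>)"
      "op_invertible ip (multiplier act ip J m \<psi>)"
      by (fact frame_operator_properties[OF mult(2,3)])+
  next
    assume neg: "negative_seq J m"
    \<comment> \<open>The positive case is applied to \<open>- m\<close>, which has the same
      absolute values; its multiplier is \<open>- ?T\<close>.\<close>
    let ?n = "\<lambda>j. - m j" and ?T = "multiplier act ip J m \<psi>"
    have central': "?n ` J \<subseteq> alg_center" using central by (auto simp: alg_center_def)
    have semi': "semi_normalized J ?n" using semi by (simp add: semi_normalized_uminus)
    have "positive_seq J ?n" using neg by (simp add: negative_seq_def positive_seq_def)
    note mult = positive_multiplier[OF frame central' semi' this]
    have T: "multiplier act ip J ?n \<psi> = (\<lambda>f. - ?T f)"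
      by (rule ext) (simp add: multiplier_def act_minus_left infsum_uminus)
    note props = frame_operator_properties[OF mult(2,3), unfolded T]
    show "multiplier_converges act ip J m \<psi>"
      using mult(1) by (simp add: multiplier_converges_def act_minus_left summable_on_uminus)
    show "op_negative ip ?T" using props(1) by (simp add: op_negative_def)
    show "op_self_adjoint ip ?T"
      using props(2) by (simp add: op_self_adjoint_def ip_minus_left ip_minus_right)
    show "op_invertible ip ?T" using props(3) by (rule op_invertible_uminus)
  }
qed

end
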